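(* Assume the contact 3-manifold $(M,\xi)$ admits some compatible metric with instantaneous rotation $\theta'$ and $Ricci(X_\alpha)<\frac{\theta'^2}{2}$ everywhere. Then for any $c\le\frac{\theta'^2}{2}$, there exists some compatible metric with instantaneous rotation $\theta'$ and $Ricci(X_\alpha)<c$ (everywhere on $M$). Here $X_\alpha$ denotes the Reeb vector field associated with the respective metric.
   Context: $M$ is a closed, connected, oriented 3-manifold; all objects are smooth. A (positive) contact form is a 1-form $\alpha$ with $\alpha\wedge d\alpha>0$; $\xi=\ker\alpha$ is a contact structure. Convention: $d\alpha(u,v)=u(\alpha(v))-v(\alpha(u))-\alpha([u,v])$. The Reeb vector field $X_\alpha$ is the unique vector field with $d\alpha(X_\alpha,\cdot)=0$, $\alpha(X_\alpha)=1$. A Riemannian metric $g$ is compatible with $(M,\xi)$ if $g(u,v)=\frac{1}{\theta'}d\alpha(u,Jv)+\alpha(u)\alpha(v)$ for all $u,v\in TM$, where $\alpha$ is a contact form for $\xi$, $\theta'$ is a positive constant (the instantaneous rotation), and $J$ is a complex structure on $\xi$ (with $d\alpha(u,Ju)>0$ for $0\ne u\in\xi$), extended to $TM$ by first projecting to $\xi$ along $X_\alpha$. $X_\alpha$ is called the Reeb vector field associated with $g$; $Ricci(X_\alpha)=k(e,X_\alpha)+k(Je,X_\alpha)$ for a unit $e\in\xi$, $k$ the sectional curvature of $g$. *)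

theory Defs
  imports "HOL-Analysis.Analysis"
begin

section \<open>Smooth functions on open subsets of three-space\<close>

definition partial :: "3 \<Rightarrow> (real^3 \<Rightarrow> real) \<Rightarrow> real^3 \<Rightarrow> real" where
  "partial i f x = frechet_derivative f (at x) (axis i 1)"

primrec Ck_on :: "nat \<Rightarrow> (real^3) set \<Rightarrow> (real^3 \<Rightarrow> real) \<Rightarrow> bool" where
  "Ck_on 0 U f \<longleftrightarrow> continuous_on U f"
| "Ck_on (Suc k) U f \<longleftrightarrow> f differentiable_on U \<and> (\<forall>i. Ck_on k U (partial i f))"

text \<open>Only used for open \<open>U\<close>.\<close>

definition smooth_on :: "(real^3) set \<Rightarrow> (real^3 \<Rightarrow> real) \<Rightarrow> bool" where
  "smooth_on U f \<longleftrightarrow> (\<forall>k. Ck_on k U f)"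


section \<open>Closed connected oriented 3-manifolds\<close>

text \<open>A chart is a domain together with a coordinate map; the values of the map outside the
  domain are irrelevant.\<close>

type_synonym 'a chart = "'a set \<times> ('a \<Rightarrow> real^3)"

abbreviation dom_of :: "'a chart \<Rightarrow> 'a set" where "dom_of c \<equiv> fst c"
abbreviation coord :: "'a chart \<Rightarrow> 'a \<Rightarrow> real^3" where "coord c \<equiv> snd c"
abbreviation img_of :: "'a chart \<Rightarrow> (real^3) set" where "img_of c \<equiv> coord c ` dom_of c"

definition coord_inv :: "'a chart \<Rightarrow> real^3 \<Rightarrow> 'a" where
  "coord_inv c = the_inv_into (dom_of c) (coord c)"

definition transition :: "'a chart \<Rightarrow> 'a chart \<Rightarrow> real^3 \<Rightarrow> real^3" where
  "transition c d = coord d \<circ> coord_inv c"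

text \<open>The smooth structure and the orientation are both given by an atlas whose transition maps
  are smooth with positive Jacobian determinant. The atlas need not be maximal. Second countability
  follows from compactness.\<close>

definition closed_connected_oriented_3_manifold :: "'a topology \<Rightarrow> 'a chart set \<Rightarrow> bool" where
  "closed_connected_oriented_3_manifold M A \<longleftrightarrow>
     Hausdorff_space M \<and> compact_space M \<and> connected_space M \<and>
     topspace M = (\<Union>c\<in>A. dom_of c) \<and>
     (\<forall>c\<in>A. openin M (dom_of c) \<and> open (img_of c) \<and>
        homeomorphic_map (subtopology M (dom_of c)) (top_of_set (img_of c)) (coord c)) \<and>
     (\<forall>c\<in>A. \<forall>d\<in>A.
        (\<forall>i. smooth_on (coord c ` (dom_of c \<inter> dom_of d)) (\<lambda>x. transition c d x $ i)) \<and>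
        (\<forall>x\<in>coord c ` (dom_of c \<inter> dom_of d). det (jacobian (transition c d) (at x)) > 0))"

definition points :: "'a chart set \<Rightarrow> 'a set" where
  "points A = (\<Union>c\<in>A. dom_of c)"


section \<open>Tangent vectors\<close>

text \<open>A tangent vector at \<open>p\<close> is the family of its coordinate vectors in the charts around \<open>p\<close>,
  which transform by the Jacobian matrices of the transition maps; it is set to zero at all other
  index values, so that equality of tangent vectors is equality of functions. Linear combinations
  are taken chartwise.\<close>

type_synonym 'a tangent = "'a chart \<Rightarrow> real^3"

definition tangent_space :: "'a chart set \<Rightarrow> 'a \<Rightarrow> 'a tangent set" where
  "tangent_space A p = {v.
     (\<forall>c. \<not> (c \<in> A \<and> p \<in> dom_of c) \<longrightarrow> v c = 0) \<and>
     (\<forall>c\<in>A. \<forall>d\<in>A. p \<in> dom_of c \<inter> dom_of d \<longrightarrow>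
        v d = jacobian (transition c d) (at (coord c p)) *v v c)}"

text \<open>The tangent vector at \<open>p\<close> whose coordinate vector in the chart \<open>c\<close> is \<open>w\<close>.\<close>

definition tangent_of :: "'a chart set \<Rightarrow> 'a chart \<Rightarrow> 'a \<Rightarrow> real^3 \<Rightarrow> 'a tangent" where
  "tangent_of A c p w = (\<lambda>d.
     if d \<in> A \<and> p \<in> dom_of d then jacobian (transition c d) (at (coord c p)) *v w else 0)"

definition coord_vector :: "'a chart set \<Rightarrow> 'a chart \<Rightarrow> 'a \<Rightarrow> 3 \<Rightarrow> 'a tangent" where
  "coord_vector A c p i = tangent_of A c p (axis i 1)"

definition linear_form_on :: "'a tangent set \<Rightarrow> ('a tangent \<Rightarrow> real) \<Rightarrow> bool" where
  "linear_form_on V f \<longleftrightarrow>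
     (\<forall>u\<in>V. \<forall>v\<in>V. \<forall>r s. f (\<lambda>c. r *\<^sub>R u c + s *\<^sub>R v c) = r * f u + s * f v)"

text \<open>Several notions below are given by coordinate formulas whose value at a point is independent
  of the chart; they are evaluated in an arbitrarily selected chart around the point.\<close>

definition chart_at :: "'a chart set \<Rightarrow> 'a \<Rightarrow> 'a chart" where
  "chart_at A p = (SOME c. c \<in> A \<and> p \<in> dom_of c)"


section \<open>Vector fields, 1-forms and Riemannian metrics\<close>

type_synonym 'a vector_field = "'a \<Rightarrow> 'a tangent"
type_synonym 'a form1 = "'a \<Rightarrow> 'a tangent \<Rightarrow> real"
type_synonym 'a metric = "'a \<Rightarrow> 'a tangent \<Rightarrow> 'a tangent \<Rightarrow> real"

definition smooth_vector_field :: "'a chart set \<Rightarrow> 'a vector_field \<Rightarrow> bool" where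
  "smooth_vector_field A X \<longleftrightarrow>
     (\<forall>p\<in>points A. X p \<in> tangent_space A p) \<and>
     (\<forall>c\<in>A. \<forall>i. smooth_on (img_of c) (\<lambda>x. X (coord_inv c x) c $ i))"

definition form_comp :: "'a chart set \<Rightarrow> 'a chart \<Rightarrow> 'a form1 \<Rightarrow> 3 \<Rightarrow> real^3 \<Rightarrow> real" where
  "form_comp A c \<alpha> i x = \<alpha> (coord_inv c x) (coord_vector A c (coord_inv c x) i)"

definition smooth_1_form :: "'a chart set \<Rightarrow> 'a form1 \<Rightarrow> bool" where
  "smooth_1_form A \<alpha> \<longleftrightarrow>
     (\<forall>p\<in>points A. linear_form_on (tangent_space A p) (\<alpha> p)) \<and>
     (\<forall>c\<in>A. \<forall>i. smooth_on (img_of c) (form_comp A c \<alpha> i))"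

text \<open>The exterior derivative with the convention
  \<open>d\<alpha>(U,V) = U(\<alpha>(V)) - V(\<alpha>(U)) - \<alpha>([U,V])\<close> (no factor 1/2). On coordinate fields, whose brackets
  vanish, this reads \<open>d\<alpha>(\<partial>\<^sub>i,\<partial>\<^sub>j) = \<partial>\<^sub>i \<alpha>\<^sub>j - \<partial>\<^sub>j \<alpha>\<^sub>i\<close>.\<close>

definition ext_deriv :: "'a chart set \<Rightarrow> 'a form1 \<Rightarrow> 'a metric" where
  "ext_deriv A \<alpha> p u v = (let c = chart_at A p; x = coord c p in
     \<Sum>i\<in>UNIV. \<Sum>j\<in>UNIV.
       (partial i (form_comp A c \<alpha> j) x - partial j (form_comp A c \<alpha> i) x) * u c $ i * v c $ j)"

definition metric_matrix :: "'a chart set \<Rightarrow> 'a chart \<Rightarrow> 'a metric \<Rightarrow> real^3 \<Rightarrow> real^3^3" where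
  "metric_matrix A c g x = (\<chi> i j.
     g (coord_inv c x) (coord_vector A c (coord_inv c x) i) (coord_vector A c (coord_inv c x) j))"

definition riemannian_metric :: "'a chart set \<Rightarrow> 'a metric \<Rightarrow> bool" where
  "riemannian_metric A g \<longleftrightarrow>
     (\<forall>p\<in>points A.
        (\<forall>u\<in>tangent_space A p. linear_form_on (tangent_space A p) (g p u)) \<and>
        (\<forall>u\<in>tangent_space A p. \<forall>v\<in>tangent_space A p. g p u v = g p v u) \<and>
        (\<forall>u\<in>tangent_space A p. u \<noteq> (\<lambda>c. 0) \<longrightarrow> g p u u > 0)) \<and>
     (\<forall>c\<in>A. \<forall>i j. smooth_on (img_of c) (\<lambda>x. metric_matrix A c g x $ i $ j))"


section \<open>Levi-Civita connection and sectional curvature\<close>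

text \<open>\<open>christoffel A c g k i j\<close> is the \<open>k\<close>-th component of \<open>\<nabla>\<^bsub>\<partial>i\<^esub> \<partial>j\<close>.\<close>

definition christoffel ::
    "'a chart set \<Rightarrow> 'a chart \<Rightarrow> 'a metric \<Rightarrow> 3 \<Rightarrow> 3 \<Rightarrow> 3 \<Rightarrow> real^3 \<Rightarrow> real" where
  "christoffel A c g k i j x = (1/2) * (\<Sum>l\<in>UNIV. matrix_inv (metric_matrix A c g x) $ k $ l *
     (partial i (\<lambda>y. metric_matrix A c g y $ j $ l) x
      + partial j (\<lambda>y. metric_matrix A c g y $ i $ l) x
      - partial l (\<lambda>y. metric_matrix A c g y $ i $ j) x))"

text \<open>\<open>riemann_coeff A c g l i j k\<close> is the \<open>l\<close>-th component of \<open>R(\<partial>\<^sub>i,\<partial>\<^sub>j)\<partial>\<^sub>k\<close>, where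
  \<open>R(u,v)w = \<nabla>\<^sub>u\<nabla>\<^sub>v w - \<nabla>\<^sub>v\<nabla>\<^sub>u w - \<nabla>\<^bsub>[u,v]\<^esub> w\<close>.\<close>

definition riemann_coeff ::
    "'a chart set \<Rightarrow> 'a chart \<Rightarrow> 'a metric \<Rightarrow> 3 \<Rightarrow> 3 \<Rightarrow> 3 \<Rightarrow> 3 \<Rightarrow> real^3 \<Rightarrow> real" where
  "riemann_coeff A c g l i j k x =
     partial i (christoffel A c g l j k) x - partial j (christoffel A c g l i k) x
     + (\<Sum>m\<in>UNIV. christoffel A c g l i m x * christoffel A c g m j k x
               - christoffel A c g l j m x * christoffel A c g m i k x)"

definition curvature ::
    "'a chart set \<Rightarrow> 'a metric \<Rightarrow> 'a \<Rightarrow> 'a tangent \<Rightarrow> 'a tangent \<Rightarrow> 'a tangent \<Rightarrow> 'a tangent" where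
  "curvature A g p u v w = (let c = chart_at A p; x = coord c p in
     tangent_of A c p (\<chi> l. \<Sum>i\<in>UNIV. \<Sum>j\<in>UNIV. \<Sum>k\<in>UNIV.
       riemann_coeff A c g l i j k x * u c $ i * v c $ j * w c $ k))"

definition sectional_curvature ::
    "'a chart set \<Rightarrow> 'a metric \<Rightarrow> 'a \<Rightarrow> 'a tangent \<Rightarrow> 'a tangent \<Rightarrow> real" where
  "sectional_curvature A g p u v =
     g p (curvature A g p u v v) u / (g p u u * g p v v - (g p u v)\<^sup>2)"


section \<open>Contact structures and compatible metrics\<close>

text \<open>Positivity of \<open>\<alpha> \<and> d\<alpha>\<close>: it is positive on every positively oriented triple of tangent
  vectors, i.e. every triple whose coordinate vectors in the charts of the oriented atlas have
  positive determinant.\<close>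

definition contact_form :: "'a chart set \<Rightarrow> 'a form1 \<Rightarrow> bool" where
  "contact_form A \<alpha> \<longleftrightarrow> smooth_1_form A \<alpha> \<and>
     (\<forall>p\<in>points A. \<forall>u\<in>tangent_space A p. \<forall>v\<in>tangent_space A p. \<forall>w\<in>tangent_space A p.
        det (vector [u (chart_at A p), v (chart_at A p), w (chart_at A p)] :: real^3^3) > 0 \<longrightarrow>
        \<alpha> p u * ext_deriv A \<alpha> p v w + \<alpha> p v * ext_deriv A \<alpha> p w u
          + \<alpha> p w * ext_deriv A \<alpha> p u v > 0)"

text \<open>\<open>\<xi>\<close> assigns to each point a set of tangent vectors.\<close>

definition contact_form_for ::
    "'a chart set \<Rightarrow> ('a \<Rightarrow> 'a tangent set) \<Rightarrow> 'a form1 \<Rightarrow> bool" where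
  "contact_form_for A \<xi> \<alpha> \<longleftrightarrow> contact_form A \<alpha> \<and>
     (\<forall>p\<in>points A. \<xi> p = {v \<in> tangent_space A p. \<alpha> p v = 0})"

definition contact_structure :: "'a chart set \<Rightarrow> ('a \<Rightarrow> 'a tangent set) \<Rightarrow> bool" where
  "contact_structure A \<xi> \<longleftrightarrow> (\<exists>\<alpha>. contact_form_for A \<xi> \<alpha>)"

definition reeb_field :: "'a chart set \<Rightarrow> 'a form1 \<Rightarrow> 'a vector_field \<Rightarrow> bool" where
  "reeb_field A \<alpha> X \<longleftrightarrow> smooth_vector_field A X \<and>
     (\<forall>p\<in>points A. \<alpha> p (X p) = 1 \<and> (\<forall>v\<in>tangent_space A p. ext_deriv A \<alpha> p (X p) v = 0))"

text \<open>The extension to the tangent bundle of an endomorphism \<open>J\<close> of \<open>ker \<alpha>\<close>, by first projecting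
  to \<open>ker \<alpha>\<close> along \<open>X\<close>.\<close>

definition extend_endo ::
    "'a form1 \<Rightarrow> 'a vector_field \<Rightarrow> ('a \<Rightarrow> 'a tangent \<Rightarrow> 'a tangent) \<Rightarrow> 'a \<Rightarrow> 'a tangent \<Rightarrow> 'a tangent"
  where "extend_endo \<alpha> X J p v = J p (\<lambda>c. v c - \<alpha> p v *\<^sub>R X p c)"

text \<open>The last conjunct is smoothness of \<open>J\<close>, expressed for its extension to the tangent bundle.\<close>

definition complex_structure_on ::
    "'a chart set \<Rightarrow> ('a \<Rightarrow> 'a tangent set) \<Rightarrow> 'a form1 \<Rightarrow> 'a vector_field \<Rightarrow>
     ('a \<Rightarrow> 'a tangent \<Rightarrow> 'a tangent) \<Rightarrow> bool" where
  "complex_structure_on A \<xi> \<alpha> X J \<longleftrightarrow>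
     (\<forall>p\<in>points A.
        (\<forall>u\<in>\<xi> p. J p u \<in> \<xi> p \<and> J p (J p u) = (\<lambda>c. - u c)) \<and>
        (\<forall>u\<in>\<xi> p. \<forall>v\<in>\<xi> p. \<forall>r s.
           J p (\<lambda>c. r *\<^sub>R u c + s *\<^sub>R v c) = (\<lambda>c. r *\<^sub>R J p u c + s *\<^sub>R J p v c))) \<and>
     (\<forall>c\<in>A. \<forall>i j. smooth_on (img_of c)
        (\<lambda>x. extend_endo \<alpha> X J (coord_inv c x) (coord_vector A c (coord_inv c x) j) c $ i))"

text \<open>\<open>g\<close> is compatible with \<open>\<xi>\<close>, has instantaneous rotation \<open>\<theta>\<close>, and this is witnessed by the
  contact form \<open>\<alpha>\<close> with Reeb field \<open>X\<close> and by the complex structure \<open>J\<close> on \<open>\<xi>\<close>.\<close>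

definition compatible_metric ::
    "'a chart set \<Rightarrow> ('a \<Rightarrow> 'a tangent set) \<Rightarrow> real \<Rightarrow> 'a metric \<Rightarrow> 'a form1 \<Rightarrow> 'a vector_field \<Rightarrow>
     ('a \<Rightarrow> 'a tangent \<Rightarrow> 'a tangent) \<Rightarrow> bool" where
  "compatible_metric A \<xi> \<theta> g \<alpha> X J \<longleftrightarrow>
     \<theta> > 0 \<and> riemannian_metric A g \<and> contact_form_for A \<xi> \<alpha> \<and> reeb_field A \<alpha> X \<and>
     complex_structure_on A \<xi> \<alpha> X J \<and>
     (\<forall>p\<in>points A. \<forall>u\<in>\<xi> p. u \<noteq> (\<lambda>c. 0) \<longrightarrow> ext_deriv A \<alpha> p u (J p u) > 0) \<and>
     (\<forall>p\<in>points A. \<forall>u\<in>tangent_space A p. \<forall>v\<in>tangent_space A p.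
        g p u v = 1 / \<theta> * ext_deriv A \<alpha> p u (extend_endo \<alpha> X J p v) + \<alpha> p u * \<alpha> p v)"

text \<open>\<open>Ricci(X)\<close> at \<open>p\<close>, computed with a unit vector \<open>e\<close> of the contact plane.\<close>

definition ricci_reeb ::
    "'a chart set \<Rightarrow> 'a metric \<Rightarrow> 'a vector_field \<Rightarrow> ('a \<Rightarrow> 'a tangent \<Rightarrow> 'a tangent) \<Rightarrow>
     'a \<Rightarrow> 'a tangent \<Rightarrow> real" where
  "ricci_reeb A g X J p e =
     sectional_curvature A g p e (X p) + sectional_curvature A g p (J p e) (X p)"

text \<open>\<open>Ricci(X) < c\<close> everywhere. The value does not depend on the unit vector \<open>e\<close>.\<close>

definition ricci_reeb_less ::
    "'a chart set \<Rightarrow> ('a \<Rightarrow> 'a tangent set) \<Rightarrow> 'a metric \<Rightarrow> 'a vector_field \<Rightarrow>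
     ('a \<Rightarrow> 'a tangent \<Rightarrow> 'a tangent) \<Rightarrow> real \<Rightarrow> bool" where
  "ricci_reeb_less A \<xi> g X J c \<longleftrightarrow>
     (\<forall>p\<in>points A. \<forall>e\<in>\<xi> p. g p e e = 1 \<longrightarrow> ricci_reeb A g X J p e < c)"

end

theory Submission
  imports Defs
begin

text \<open>
  For a compatible metric \<open>g\<close> with contact form \<open>\<alpha>\<close> and Reeb field \<open>X\<close>, the Ricci curvature of the
  Reeb field measures how far the Reeb flow is from acting by isometries:
  \<open>Ricci(X) = \<theta>\<^sup>2/2 - |L\<^sub>X g|\<^sup>2/4\<close> (\<open>ricci_eq\<close>, from the local formula \<open>ricci_X\<close>). Multiply \<open>\<alpha>\<close> by a constant
  \<open>k > 0\<close> and keep \<open>J\<close> and \<open>\<theta>\<close>. The Reeb field becomes \<open>X/k\<close>, and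
  \<open>g' = k g + (k\<^sup>2 - k) \<alpha>\<otimes>\<alpha>\<close> is again compatible with the same contact structure. As \<open>X\<close> preserves
  \<open>\<alpha>\<close>, the tensor \<open>L\<^sub>X g\<close> does not change, and its squared norm is divided by \<open>k\<^sup>2\<close>
  (\<open>torsion_rescale\<close>); hence \<open>Ricci(X/k) = \<theta>\<^sup>2/2 - |L\<^sub>X g|\<^sup>2/(4 k\<^sup>2)\<close>.

  The hypothesis \<open>Ricci(X) < \<theta>\<^sup>2/2\<close> says exactly that \<open>|L\<^sub>X g|\<^sup>2\<close> is positive everywhere. It is a
  continuous function on a compact manifold, so it has a positive lower bound
  (\<open>tors_bounded_below\<close>), and a small \<open>k\<close> pushes the Ricci curvature below any given constant.

  The local formula comes from the endomorphism \<open>A = \<nabla>X\<close>. Its symmetric part is \<open>L\<^sub>X g / 2\<close> and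
  its skew part is \<open>(\<theta>/2) J\<close>. Reeb orbits are geodesics, so
  \<open>R(u,X)X = - (\<nabla>\<^sub>X A) u - A (A u)\<close>, and the trace of the right-hand side is \<open>- tr (A A)\<close> because
  the Reeb field is divergence free. The definitions involve an arbitrarily selected chart at each
  point. Therefore the exterior derivative, and the function \<open>|L\<^sub>X g|\<^sup>2\<close>, must also be shown to be
  independent of the chart (\<open>exterior_transition\<close>, \<open>tors_chart\<close>); both rest on the symmetry of second
  derivatives, \<open>partial_commute\<close>.
\<close>

section \<open>Partial derivatives\<close>

lemma partial_eqI:
  assumes "(f has_derivative f') (at x)"
  shows "partial i f x = f' (axis i 1)"
  using frechet_derivative_at[OF assms] by (simp add: partial_def)

lemma has_derivative_partial:
  assumes "f differentiable (at x)"
  shows "(f has_derivative (\<lambda>v. \<Sum>i\<in>UNIV. v $ i * partial i f x)) (at x)"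
proof -
  have D: "(f has_derivative frechet_derivative f (at x)) (at x)"
    using assms frechet_derivative_works by blast
  interpret linear "frechet_derivative f (at x)"
    using assms by (rule linear_frechet_derivative)
  have "frechet_derivative f (at x) v = (\<Sum>i\<in>UNIV. v $ i * partial i f x)" for v
  proof -
    have "frechet_derivative f (at x) v = frechet_derivative f (at x) (\<Sum>i\<in>UNIV. v $ i *\<^sub>R axis i 1)"
      by (simp flip: scalar_mult_eq_scaleR add: basis_expansion)
    also have "\<dots> = (\<Sum>i\<in>UNIV. v $ i * partial i f x)"
      by (simp only: sum scale partial_def real_scaleR_def)
    finally show ?thesis .
  qed
  then have "frechet_derivative f (at x) = (\<lambda>v. \<Sum>i\<in>UNIV. v $ i * partial i f x)"
    by (rule ext)
  with D show ?thesis by simp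
qed

lemma partial_const [simp]: "partial i (\<lambda>y. k) x = 0"
  by (simp add: partial_def)

lemma partial_add:
  assumes "f differentiable (at x)" "g differentiable (at x)"
  shows "partial i (\<lambda>y. f y + g y) x = partial i f x + partial i g x"
  by (subst partial_eqI[OF has_derivative_add[OF assms[unfolded frechet_derivative_works]]])
     (simp add: partial_def)

lemma partial_diff:
  assumes "f differentiable (at x)" "g differentiable (at x)"
  shows "partial i (\<lambda>y. f y - g y) x = partial i f x - partial i g x"
  by (subst partial_eqI[OF has_derivative_diff[OF assms[unfolded frechet_derivative_works]]])
     (simp add: partial_def)

lemma partial_mult:
  assumes "f differentiable (at x)" "g differentiable (at x)"
  shows "partial i (\<lambda>y. f y * g y) x = partial i f x * g x + f x * partial i g x"
  by (subst partial_eqI[OF has_derivative_mult[OF assms[unfolded frechet_derivative_works]]])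
     (simp add: partial_def)

lemma partial_cmult:
  assumes "f differentiable (at x)"
  shows "partial i (\<lambda>y. k * f y) x = k * partial i f x"
  using partial_mult[of "\<lambda>y. k" x f i] assms by simp

lemma partial_sum:
  assumes "finite I" "\<And>m. m \<in> I \<Longrightarrow> f m differentiable (at x)"
  shows "partial i (\<lambda>y. \<Sum>m\<in>I. f m y) x = (\<Sum>m\<in>I. partial i (f m) x)"
  using assms
proof (induction I rule: finite_induct)
  case (insert m I)
  then show ?case by (simp add: partial_add differentiable_sum)
qed simp

lemma partial_local:
  assumes "open U" "x \<in> U" "\<And>y. y \<in> U \<Longrightarrow> f y = g y"
  shows "partial i f x = partial i g x"
proof -
  have "(f has_derivative f') (at x) \<longleftrightarrow> (g has_derivative f') (at x)" for f'
    using assms has_derivative_transform_within_open[of f f' x UNIV U g]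
      has_derivative_transform_within_open[of g f' x UNIV U f] by auto
  then show ?thesis by (simp add: partial_def frechet_derivative_def)
qed

lemma differentiable_local:
  assumes "open U" "x \<in> U" "\<And>y. y \<in> U \<Longrightarrow> f y = g y" "g differentiable (at x)"
  shows "f differentiable (at x)"
  using assms has_derivative_transform_within_open[of g _ x UNIV U f]
  unfolding differentiable_def by force

lemma differentiable_vecI:
  fixes T :: "real^3 \<Rightarrow> real^3"
  assumes "\<And>i. (\<lambda>y. T y $ i) differentiable (at x)"
  shows "T differentiable (at x)"
  unfolding differentiable_componentwise_within[of T]
  using assms by (auto simp: Basis_vec_def inner_axis)

lemma jacobian_partial:
  fixes T :: "real^3 \<Rightarrow> real^3"
  assumes "\<And>i. (\<lambda>y. T y $ i) differentiable (at x)"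
  shows "jacobian T (at x) $ i $ j = partial j (\<lambda>y. T y $ i) x"
proof -
  have "(T has_derivative frechet_derivative T (at x)) (at x)"
    using differentiable_vecI[OF assms] frechet_derivative_works by blast
  then have "((\<lambda>y. T y $ i) has_derivative (\<lambda>v. frechet_derivative T (at x) v $ i)) (at x)"
    using bounded_linear.has_derivative[OF bounded_linear_vec_nth] by blast
  from partial_eqI[OF this] show ?thesis
    by (simp add: jacobian_def matrix_def)
qed

lemma differentiable_chain:
  fixes T :: "real^3 \<Rightarrow> real^3" and f :: "real^3 \<Rightarrow> real"
  assumes "\<And>i. (\<lambda>y. T y $ i) differentiable (at x)" "f differentiable (at (T x))"
  shows "(\<lambda>y. f (T y)) differentiable (at x)"
  using differentiable_chain_at[OF differentiable_vecI[OF assms(1)] assms(2)] by (simp add: o_def)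

lemma partial_chain:
  fixes T :: "real^3 \<Rightarrow> real^3" and f :: "real^3 \<Rightarrow> real"
  assumes T: "\<And>i. (\<lambda>y. T y $ i) differentiable (at x)" and f: "f differentiable (at (T x))"
  shows "partial i (\<lambda>y. f (T y)) x = (\<Sum>j\<in>UNIV. partial i (\<lambda>y. T y $ j) x * partial j f (T x))"
proof -
  have "(T has_derivative frechet_derivative T (at x)) (at x)"
    using differentiable_vecI[OF T] frechet_derivative_works by blast
  from has_derivative_compose[OF this has_derivative_partial[OF f]]
  have "partial i (\<lambda>y. f (T y)) x
      = (\<Sum>j\<in>UNIV. frechet_derivative T (at x) (axis i 1) $ j * partial j f (T x))"
    by (rule partial_eqI)
  moreover have "frechet_derivative T (at x) (axis i 1) $ j = partial i (\<lambda>y. T y $ j) x" for j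
    using jacobian_partial[OF T, of j i] by (simp add: jacobian_def matrix_def)
  ultimately show ?thesis by simp
qed

section \<open>Smooth functions and the symmetry of second derivatives\<close>

lemma Ck_on_cong:
  assumes "open U" "\<And>y. y \<in> U \<Longrightarrow> f y = g y" "Ck_on k U f"
  shows "Ck_on k U g"
  using assms(2,3)
proof (induction k arbitrary: f g)
  case 0
  then show ?case by (simp cong: continuous_on_cong_simp)
next
  case (Suc k)
  have "g differentiable_on U"
    using Suc.prems assms(1) differentiable_local[of U _ g f]
    by (auto simp: differentiable_on_eq_differentiable_at)
  moreover have "Ck_on k U (partial i g)" for i
    using Suc.IH[of "partial i f" "partial i g"] partial_local[OF assms(1) _ Suc.prems(1)] Suc.prems(2)
    by auto
  ultimately show ?case by simp
qed

lemma Ck_on_Suc_imp: "Ck_on (Suc k) U f \<Longrightarrow> Ck_on k U f"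
  by (induction k arbitrary: f) (auto intro: differentiable_imp_continuous_on)

lemma Ck_on_const: "Ck_on k U (\<lambda>y. r)"
proof (induction k arbitrary: r)
  case (Suc k)
  have "partial i (\<lambda>y. r) = (\<lambda>y. 0)" for i by auto
  then show ?case using Suc by simp
qed simp

lemma Ck_on_add:
  assumes "open U" "Ck_on k U f" "Ck_on k U g"
  shows "Ck_on k U (\<lambda>y. f y + g y)"
  using assms(2,3)
proof (induction k arbitrary: f g)
  case 0
  then show ?case by (auto intro: continuous_intros)
next
  case (Suc k)
  have "Ck_on k U (partial i (\<lambda>y. f y + g y))" for i
  proof (rule Ck_on_cong[OF assms(1)])
    show "Ck_on k U (\<lambda>y. partial i f y + partial i g y)" using Suc by auto
  next
    fix y assume "y \<in> U"
    then have "f differentiable (at y)" "g differentiable (at y)"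
      using Suc.prems assms(1) by (auto simp: differentiable_on_eq_differentiable_at)
    then show "partial i f y + partial i g y = partial i (\<lambda>y. f y + g y) y"
      by (simp add: partial_add)
  qed
  moreover have "(\<lambda>y. f y + g y) differentiable_on U"
    using Suc.prems by (auto intro: differentiable_on_add)
  ultimately show ?case by simp
qed

lemma Ck_on_mult:
  assumes "open U" "Ck_on k U f" "Ck_on k U g"
  shows "Ck_on k U (\<lambda>y. f y * g y)"
  using assms(2,3)
proof (induction k arbitrary: f g)
  case 0
  then show ?case by (auto intro: continuous_intros)
next
  case (Suc k)
  have "Ck_on k U (partial i (\<lambda>y. f y * g y))" for i
  proof (rule Ck_on_cong[OF assms(1)])
    have "Ck_on k U f" "Ck_on k U g"
      using Suc.prems Ck_on_Suc_imp by blast+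
    then show "Ck_on k U (\<lambda>y. partial i f y * g y + f y * partial i g y)"
      using Suc.prems by (auto intro!: Ck_on_add[OF assms(1)] Suc.IH)
  next
    fix y assume "y \<in> U"
    then have "f differentiable (at y)" "g differentiable (at y)"
      using Suc.prems assms(1) by (auto simp: differentiable_on_eq_differentiable_at)
    then show "partial i f y * g y + f y * partial i g y = partial i (\<lambda>y. f y * g y) y"
      by (simp add: partial_mult)
  qed
  moreover have "(\<lambda>y. f y * g y) differentiable_on U"
    using Suc.prems by (auto intro: differentiable_on_mult)
  ultimately show ?case by simp
qed

lemma smooth_on_const: "smooth_on U (\<lambda>y. r)"
  by (simp add: smooth_on_def Ck_on_const)

lemma smooth_on_add: "open U \<Longrightarrow> smooth_on U f \<Longrightarrow> smooth_on U g \<Longrightarrow> smooth_on U (\<lambda>y. f y + g y)"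
  by (simp add: smooth_on_def Ck_on_add)

lemma smooth_on_mult: "open U \<Longrightarrow> smooth_on U f \<Longrightarrow> smooth_on U g \<Longrightarrow> smooth_on U (\<lambda>y. f y * g y)"
  by (simp add: smooth_on_def Ck_on_mult)

lemma smooth_on_partial: "smooth_on U f \<Longrightarrow> smooth_on U (partial i f)"
  unfolding smooth_on_def using Ck_on.simps(2) by blast

lemma smooth_on_differentiable:
  assumes "smooth_on U f" "open U" "x \<in> U"
  shows "f differentiable (at x)"
  using assms Ck_on.simps(2)[of 0 U f]
  by (auto simp: smooth_on_def differentiable_on_eq_differentiable_at simp del: Ck_on.simps)

lemma partial_along_axis:
  assumes "f differentiable (at (x + s *\<^sub>R axis i 1))"
  shows "((\<lambda>t. f (x + t *\<^sub>R axis i 1)) has_real_derivative partial i f (x + s *\<^sub>R axis i 1)) (at s)"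
proof -
  have "((\<lambda>t. x + t *\<^sub>R axis i 1 :: real^3) has_derivative (\<lambda>t. t *\<^sub>R axis i 1)) (at s)"
    by (auto intro!: derivative_eq_intros)
  moreover have "(f has_derivative frechet_derivative f (at (x + s *\<^sub>R axis i 1))) (at (x + s *\<^sub>R axis i 1))"
    using assms frechet_derivative_works by blast
  ultimately have "((\<lambda>t. f (x + t *\<^sub>R axis i 1)) has_derivative
      (\<lambda>t. frechet_derivative f (at (x + s *\<^sub>R axis i 1)) (t *\<^sub>R axis i 1))) (at s)"
    by (rule has_derivative_compose)
  moreover have "frechet_derivative f (at (x + s *\<^sub>R axis i 1)) (t *\<^sub>R axis i 1)
      = partial i f (x + s *\<^sub>R axis i 1) * t" for t
    using linear_scale[OF linear_frechet_derivative[OF assms], of t "axis i 1"]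
    by (simp add: partial_def mult.commute)
  ultimately show ?thesis by (simp add: has_field_derivative_def)
qed

text \<open>Two applications of the mean value theorem express the second difference of \<open>f\<close> on a square
  of side \<open>h\<close> by a mixed derivative at a nearby point. The second difference does not depend on the
  order of the two directions, which forces the two mixed derivatives to agree in the limit.\<close>

lemma second_difference:
  fixes f :: "real^3 \<Rightarrow> real"
  assumes "\<And>y. y \<in> ball x r \<Longrightarrow> f differentiable (at y)"
    and "\<And>y. y \<in> ball x r \<Longrightarrow> partial i f differentiable (at y)"
    and h: "0 < h" "2 * h < r"
  shows "\<exists>z. dist x z \<le> 2 * h \<and>
    f (x + h *\<^sub>R axis j 1 + h *\<^sub>R axis i 1) - f (x + h *\<^sub>R axis i 1) - f (x + h *\<^sub>R axis j 1) + f x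
      = h\<^sup>2 * partial j (partial i f) z"
proof -
  have near: "dist x (x + s *\<^sub>R axis i 1 + t *\<^sub>R axis j 1) \<le> 2 * h"
    if "0 \<le> s" "s \<le> h" "0 \<le> t" "t \<le> h" for s t and i j :: 3
  proof -
    have "norm (s *\<^sub>R axis i 1 + t *\<^sub>R axis j 1 :: real^3) \<le> s + t"
      using norm_triangle_ineq[of "s *\<^sub>R axis i 1 :: real^3" "t *\<^sub>R axis j 1"] that
      by (simp add: norm_axis_1)
    moreover have "dist x (x + s *\<^sub>R axis i 1 + t *\<^sub>R axis j 1)
        = norm (s *\<^sub>R axis i 1 + t *\<^sub>R axis j 1 :: real^3)"
      by (simp add: dist_norm norm_minus_commute algebra_simps)
    ultimately show ?thesis using that by linarith
  qed
  have inb: "x + t *\<^sub>R axis j 1 + s *\<^sub>R axis i 1 \<in> ball x r" if "0 \<le> s" "s \<le> h" "0 \<le> t" "t \<le> h" for s t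
    using near[of t s j i] that h by simp
  define u where "u s = f (x + h *\<^sub>R axis j 1 + s *\<^sub>R axis i 1) - f (x + s *\<^sub>R axis i 1)" for s
  have "\<exists>s>0. s < h \<and> u h - u 0 = (h - 0) * (partial i f (x + h *\<^sub>R axis j 1 + s *\<^sub>R axis i 1)
      - partial i f (x + s *\<^sub>R axis i 1))"
  proof (rule MVT2)
    fix s assume s: "0 \<le> s" "s \<le> h"
    show "(u has_real_derivative (partial i f (x + h *\<^sub>R axis j 1 + s *\<^sub>R axis i 1)
        - partial i f (x + s *\<^sub>R axis i 1))) (at s)"
      unfolding u_def using inb[of s h] inb[of s 0] s h
      by (intro DERIV_diff partial_along_axis assms(1)) auto
  qed (use h in auto)
  then obtain s where s: "0 < s" "s < h" and us: "u h - u 0 = h * (partial i f (x + h *\<^sub>R axis j 1 + s *\<^sub>R axis i 1)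
      - partial i f (x + s *\<^sub>R axis i 1))" by auto
  have comm: "x + t *\<^sub>R axis j 1 + s *\<^sub>R axis i 1 = x + s *\<^sub>R axis i 1 + t *\<^sub>R axis j 1" for t
    by (simp add: algebra_simps)
  have "\<exists>t>0. t < h \<and> partial i f (x + s *\<^sub>R axis i 1 + h *\<^sub>R axis j 1) - partial i f (x + s *\<^sub>R axis i 1 + 0 *\<^sub>R axis j 1)
      = (h - 0) * partial j (partial i f) (x + s *\<^sub>R axis i 1 + t *\<^sub>R axis j 1)"
  proof (rule MVT2)
    fix t assume t: "0 \<le> t" "t \<le> h"
    show "((\<lambda>t. partial i f (x + s *\<^sub>R axis i 1 + t *\<^sub>R axis j 1)) has_real_derivative
       partial j (partial i f) (x + s *\<^sub>R axis i 1 + t *\<^sub>R axis j 1)) (at t)"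
      using inb[of s t] s t by (intro partial_along_axis assms(2)) (simp add: comm)
  qed (use h in auto)
  then obtain t where t: "0 < t" "t < h"
    and "partial i f (x + s *\<^sub>R axis i 1 + h *\<^sub>R axis j 1) - partial i f (x + s *\<^sub>R axis i 1)
      = h * partial j (partial i f) (x + s *\<^sub>R axis i 1 + t *\<^sub>R axis j 1)" by auto
  with us have "u h - u 0 = h\<^sup>2 * partial j (partial i f) (x + s *\<^sub>R axis i 1 + t *\<^sub>R axis j 1)"
    by (simp add: comm power2_eq_square)
  then show ?thesis
    using near[of s t i j] s t by (intro exI[of _ "x + s *\<^sub>R axis i 1 + t *\<^sub>R axis j 1"]) (auto simp: u_def)
qed

lemma partial_commute:
  assumes "smooth_on U f" "open U" "x \<in> U"
  shows "partial i (partial j f) x = partial j (partial i f) x"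
proof (rule ccontr)
  assume ne: "partial i (partial j f) x \<noteq> partial j (partial i f) x"
  define e where "e = dist (partial i (partial j f) x) (partial j (partial i f) x) / 2"
  have e: "e > 0" using ne by (simp add: e_def)
  have sm: "smooth_on U (partial i (partial j f))" "smooth_on U (partial j (partial i f))"
    using assms(1) smooth_on_partial by auto
  have c: "isCont (partial i (partial j f)) x" "isCont (partial j (partial i f)) x"
    using smooth_on_differentiable[OF sm(1) assms(2,3)] smooth_on_differentiable[OF sm(2) assms(2,3)]
      differentiable_imp_continuous_within by auto
  obtain d1 where d1: "d1 > 0" "\<And>z. dist z x < d1 \<Longrightarrow> dist (partial i (partial j f) z) (partial i (partial j f) x) < e"
    using c(1) e unfolding continuous_at by (auto simp: continuous_at_eps_delta dist_norm)
      (metis c(1) continuous_at_eps_delta dist_norm real_norm_def)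
  obtain d2 where d2: "d2 > 0" "\<And>z. dist z x < d2 \<Longrightarrow> dist (partial j (partial i f) z) (partial j (partial i f) x) < e"
    using c(2) e by (metis continuous_at_eps_delta)
  obtain r where r: "r > 0" "ball x r \<subseteq> U" using assms openE by blast
  \<comment> \<open>Both intermediate points lie within \<open>2 * h\<close> of \<open>x\<close>.\<close>
  define h where "h = Min {r, d1, d2} / 3"
  have h: "0 < h" "2 * h < r" "2 * h < d1" "2 * h < d2"
    using r d1(1) d2(1) by (auto simp: h_def min_def)
  have sd: "f differentiable (at y)" "partial m f differentiable (at y)" if "y \<in> ball x r" for y m
    using smooth_on_differentiable[OF _ assms(2)] assms(1) smooth_on_partial r(2) that by blast+
  obtain z where z: "dist x z \<le> 2 * h" and
    1: "f (x + h *\<^sub>R axis j 1 + h *\<^sub>R axis i 1) - f (x + h *\<^sub>R axis i 1) - f (x + h *\<^sub>R axis j 1) + f x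
      = h\<^sup>2 * partial j (partial i f) z"
    using second_difference[OF sd(1) sd(2) h(1,2)] by blast
  obtain w where w: "dist x w \<le> 2 * h" and
    2: "f (x + h *\<^sub>R axis i 1 + h *\<^sub>R axis j 1) - f (x + h *\<^sub>R axis j 1) - f (x + h *\<^sub>R axis i 1) + f x
      = h\<^sup>2 * partial i (partial j f) w"
    using second_difference[OF sd(1) sd(2) h(1,2)] by blast
  have "x + h *\<^sub>R axis i 1 + h *\<^sub>R axis j 1 = x + h *\<^sub>R axis j 1 + h *\<^sub>R axis i 1"
    by (simp add: algebra_simps)
  with 1 2 have "h\<^sup>2 * partial j (partial i f) z = h\<^sup>2 * partial i (partial j f) w"
    by (simp add: algebra_simps)
  then have zw: "partial j (partial i f) z = partial i (partial j f) w" using h by simp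
  have "dist (partial i (partial j f) w) (partial i (partial j f) x) < e"
    using d1(2)[of w] w h by (simp add: dist_commute)
  moreover have "dist (partial i (partial j f) w) (partial j (partial i f) x) < e"
    using d2(2)[of z] z h zw by (simp add: dist_commute)
  ultimately have "dist (partial i (partial j f) x) (partial j (partial i f) x) < 2 * e"
    using dist_triangle2[of "partial i (partial j f) x" "partial j (partial i f) x" "partial i (partial j f) w"]
    by (smt (verit) dist_commute)
  then show False by (simp add: e_def)
qed

section \<open>Matrix algebra\<close>

definition outer :: "real^3 \<Rightarrow> real^3 \<Rightarrow> real^3^3" where
  "outer u v = (\<chi> i j. u $ i * v $ j)"

lemma outer_nth [simp]: "outer u v $ i $ j = u $ i * v $ j"
  by (simp add: outer_def)

lemma matrix_nth: "(M ** N) $ i $ j = (\<Sum>k\<in>UNIV. M $ i $ k * N $ k $ j)"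
  by (simp add: matrix_matrix_mult_def)

lemma mult_outer: "(M::real^3^3) ** outer u v = outer (M *v u) v"
  by (simp add: vec_eq_iff matrix_nth matrix_vector_mult_def sum_distrib_right mult.assoc)

lemma outer_mult: "outer u v ** (M::real^3^3) = outer u (v v* M)"
  by (simp add: vec_eq_iff matrix_nth vector_matrix_mult_def sum_distrib_left mult_ac)

lemma outer_zero [simp]: "outer 0 v = 0" "outer u 0 = 0"
  by (simp_all add: vec_eq_iff)

lemma matrix_add_rdistrib: "((A::real^3^3) + B) ** C = A ** C + B ** C"
  by (simp add: vec_eq_iff matrix_nth sum.distrib algebra_simps)

lemma matrix_diff_rdistrib: "((A::real^3^3) - B) ** C = A ** C - B ** C"
  by (simp add: vec_eq_iff matrix_nth sum_subtractf algebra_simps)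

lemma matrix_diff_ldistrib: "(C::real^3^3) ** (A - B) = C ** A - C ** B"
  by (simp add: vec_eq_iff matrix_nth sum_subtractf algebra_simps)

lemma matrix_minus_left: "(- (A::real^3^3)) ** B = - (A ** B)"
  by (simp add: vec_eq_iff matrix_nth sum_negf)

lemma matrix_minus_right: "(A::real^3^3) ** (- B) = - (A ** B)"
  by (simp add: vec_eq_iff matrix_nth sum_negf)

lemma matrix_scaleR_left: "(k *\<^sub>R (A::real^3^3)) ** B = k *\<^sub>R (A ** B)"
  by (simp add: vec_eq_iff matrix_nth sum_distrib_left mult_ac)

lemma matrix_scaleR_right: "(A::real^3^3) ** (k *\<^sub>R B) = k *\<^sub>R (A ** B)"
  by (simp add: vec_eq_iff matrix_nth sum_distrib_left mult_ac)

lemmas matrix_ring = matrix_add_ldistrib matrix_add_rdistrib matrix_diff_ldistrib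
  matrix_diff_rdistrib matrix_minus_left matrix_minus_right matrix_scaleR_left matrix_scaleR_right
  matrix_mul_assoc

lemma trace_scaleR: "trace (k *\<^sub>R (A::real^3^3)) = k * trace A"
  by (simp add: trace_def sum_distrib_left)

lemma trace_minus: "trace (- (A::real^3^3)) = - trace A"
  by (simp add: trace_def sum_negf)

lemma trace_transpose: "trace (transpose (A::real^3^3)) = trace A"
  by (simp add: trace_def transpose_def)

lemma trace_outer: "trace (outer u v) = u \<bullet> v"
  by (simp add: trace_def inner_vec_def)

lemma transpose_add: "transpose ((A::real^3^3) + B) = transpose A + transpose B"
  by (simp add: transpose_def vec_eq_iff)

text \<open>Transposition reverses the order of the factors and changes one sign, while the trace is cyclic. This
  orthogonality of symmetric and skew forms removes all mixed terms from the curvature computation.\<close>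

lemma trace_symmetric_skew:
  fixes H B F :: "real^3^3"
  assumes "transpose H = H" "transpose B = B" "transpose F = - F"
  shows "trace (H ** F) = 0" "trace (H ** B ** (H ** F)) = 0"
proof -
  have "trace (H ** F) = trace (transpose (H ** F))" by (simp add: trace_transpose)
  also have "\<dots> = - trace (F ** H)"
    using assms by (simp add: matrix_transpose_mul matrix_minus_left trace_minus)
  finally show "trace (H ** F) = 0" by (simp add: trace_mul_sym[of F H])
  have "trace (H ** B ** (H ** F)) = trace (transpose (H ** B ** (H ** F)))"
    by (simp add: trace_transpose)
  also have "\<dots> = - trace (F ** (H ** B ** H))"
    using assms by (simp add: matrix_transpose_mul matrix_minus_left trace_minus matrix_mul_assoc)
  finally show "trace (H ** B ** (H ** F)) = 0"
    using trace_mul_sym[of F "H ** B ** H"] by (simp add: matrix_mul_assoc)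
qed

lemma matrix_inv_inverse:
  fixes G :: "real^3^3"
  assumes "invertible G"
  shows "matrix_inv G ** G = mat 1" "G ** matrix_inv G = mat 1"
proof -
  have "\<exists>H. G ** H = mat 1 \<and> H ** G = mat 1"
    using assms by (simp add: invertible_def)
  from someI_ex[OF this] show "matrix_inv G ** G = mat 1" "G ** matrix_inv G = mat 1"
    by (simp_all add: matrix_inv_def)
qed

lemma transpose_matrix_inv:
  fixes G :: "real^3^3"
  assumes "invertible G" "transpose G = G"
  shows "transpose (matrix_inv G) = matrix_inv G"
proof -
  have "transpose (G ** matrix_inv G) = mat 1"
    using matrix_inv_inverse[OF assms(1)] by (simp add: transpose_mat)
  then have *: "transpose (matrix_inv G) ** G = mat 1"
    using assms(2) by (simp add: matrix_transpose_mul)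
  have "transpose (matrix_inv G) = transpose (matrix_inv G) ** (G ** matrix_inv G)"
    using matrix_inv_inverse[OF assms(1)] by simp
  also have "\<dots> = matrix_inv G" by (simp add: matrix_mul_assoc *)
  finally show ?thesis .
qed

lemma matrix_inv_cramer:
  fixes G :: "real^3^3"
  assumes "invertible G"
  shows "matrix_inv G $ k $ l = det (\<chi> i j. if j = k then axis l 1 $ i else G $ i $ j) / det G"
proof -
  have "G *v (matrix_inv G *v axis l 1) = axis l 1"
    using matrix_inv_inverse(2)[OF assms] by (simp add: matrix_vector_mul_assoc)
  moreover have "det G \<noteq> 0" using assms by (simp add: invertible_det_nz)
  ultimately have "matrix_inv G *v axis l 1
      = (\<chi> k. det (\<chi> i j. if j = k then axis l 1 $ i else G $ i $ j) / det G)"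
    using cramer by blast
  then show ?thesis
    by (simp add: vec_eq_iff matrix_vector_mult_basis column_def)
qed

text \<open>By Cramer's rule the entries of the inverse are rational functions of the entries of the matrix.\<close>

lemma differentiable_matrix_inv:
  fixes G :: "real^3 \<Rightarrow> real^3^3"
  assumes U: "open U" "x \<in> U" and inv: "\<And>y. y \<in> U \<Longrightarrow> invertible (G y)"
    and G: "\<And>i j. (\<lambda>y. G y $ i $ j) differentiable (at x)"
  shows "(\<lambda>y. matrix_inv (G y) $ k $ l) differentiable (at x)"
proof (rule differentiable_local[OF U])
  have "(\<lambda>y. if j = k then axis l 1 $ i else G y $ i $ j) differentiable (at x)" for i j
    using G by (cases "j = k") auto
  then show "(\<lambda>y. det (\<chi> i j. if j = k then axis l 1 $ i else G y $ i $ j) / det (G y))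
      differentiable (at x)"
    using G inv[OF U(2)] unfolding invertible_det_nz det_3 vec_lambda_beta
    by (intro differentiable_divide differentiable_add differentiable_diff differentiable_mult)
qed (use matrix_inv_cramer[OF inv] in auto)

section \<open>Local tensor calculus\<close>

text \<open>The connection and the curvature depend on the matrix of components of the metric only. Formulated for
  such matrices on an open subset of three-space, the computations take place in a single chart.\<close>

definition christoffel_of :: "(real^3 \<Rightarrow> real^3^3) \<Rightarrow> 3 \<Rightarrow> 3 \<Rightarrow> 3 \<Rightarrow> real^3 \<Rightarrow> real" where
  "christoffel_of G k i j x = (1/2) * (\<Sum>l\<in>UNIV. matrix_inv (G x) $ k $ l *
     (partial i (\<lambda>y. G y $ j $ l) x + partial j (\<lambda>y. G y $ i $ l) x - partial l (\<lambda>y. G y $ i $ j) x))"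

definition riemann_of :: "(real^3 \<Rightarrow> real^3^3) \<Rightarrow> 3 \<Rightarrow> 3 \<Rightarrow> 3 \<Rightarrow> 3 \<Rightarrow> real^3 \<Rightarrow> real" where
  "riemann_of G l i j k x =
     partial i (christoffel_of G l j k) x - partial j (christoffel_of G l i k) x
     + (\<Sum>m\<in>UNIV. christoffel_of G l i m x * christoffel_of G m j k x
               - christoffel_of G l j m x * christoffel_of G m i k x)"

text \<open>The Jacobian matrix of \<open>X\<close>; as an endomorphism it sends \<open>v\<close> to the derivative of \<open>X\<close> along \<open>v\<close>.\<close>

definition grad :: "(real^3 \<Rightarrow> real^3) \<Rightarrow> real^3 \<Rightarrow> real^3^3" where
  "grad X y = (\<chi> l i. partial i (\<lambda>z. X z $ l) y)"

definition exterior :: "(real^3 \<Rightarrow> real^3) \<Rightarrow> real^3 \<Rightarrow> real^3^3" where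
  "exterior a y = (\<chi> i j. partial i (\<lambda>z. a z $ j) y - partial j (\<lambda>z. a z $ i) y)"

text \<open>Componentwise directional derivatives. They depend on the coordinates, but obey the Leibniz rule for
  matrix products, which reduces the tensor identities below to matrix algebra.\<close>

definition along :: "(real^3 \<Rightarrow> real^3) \<Rightarrow> (real^3 \<Rightarrow> real^3^3) \<Rightarrow> real^3 \<Rightarrow> real^3^3" where
  "along X H y = (\<chi> i j. \<Sum>k\<in>UNIV. X y $ k * partial k (\<lambda>z. H z $ i $ j) y)"

definition along_vec :: "(real^3 \<Rightarrow> real^3) \<Rightarrow> (real^3 \<Rightarrow> real^3) \<Rightarrow> real^3 \<Rightarrow> real^3" where
  "along_vec X a y = (\<chi> i. \<Sum>k\<in>UNIV. X y $ k * partial k (\<lambda>z. a z $ i) y)"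

text \<open>The Lie derivative along \<open>X\<close> of a covariant 2-tensor.\<close>

definition lie :: "(real^3 \<Rightarrow> real^3) \<Rightarrow> (real^3 \<Rightarrow> real^3^3) \<Rightarrow> real^3 \<Rightarrow> real^3^3" where
  "lie X G y = along X G y + transpose (grad X y) ** G y + G y ** grad X y"

text \<open>The covariant derivative of \<open>X\<close>, as an endomorphism.\<close>

definition nabla :: "(real^3 \<Rightarrow> real^3^3) \<Rightarrow> (real^3 \<Rightarrow> real^3) \<Rightarrow> real^3 \<Rightarrow> real^3^3" where
  "nabla G X y = (\<chi> l i. partial i (\<lambda>z. X z $ l) y + (\<Sum>k\<in>UNIV. christoffel_of G l i k y * X y $ k))"

text \<open>The squared norm, with respect to \<open>G\<close>, of the Lie derivative of \<open>G\<close> along \<open>X\<close>.\<close>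

definition torsion :: "(real^3 \<Rightarrow> real^3^3) \<Rightarrow> (real^3 \<Rightarrow> real^3) \<Rightarrow> real^3 \<Rightarrow> real" where
  "torsion G X y = trace (matrix_inv (G y) ** lie X G y ** (matrix_inv (G y) ** lie X G y))"

lemma grad_nth: "grad X y $ l $ i = partial i (\<lambda>z. X z $ l) y"
  by (simp add: grad_def)

lemma exterior_nth: "exterior a y $ i $ j = partial i (\<lambda>z. a z $ j) y - partial j (\<lambda>z. a z $ i) y"
  by (simp add: exterior_def)

lemma transpose_exterior: "transpose (exterior a y) = - exterior a y"
  by (simp add: vec_eq_iff transpose_def exterior_nth)

lemma along_mult:
  assumes "\<And>i j. (\<lambda>y. H y $ i $ j) differentiable (at x)" "\<And>i j. (\<lambda>y. K y $ i $ j) differentiable (at x)"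
  shows "along X (\<lambda>y. H y ** K y) x = along X H x ** K x + H x ** along X K x"
proof -
  have "partial k (\<lambda>z. (H z ** K z) $ i $ j) x
    = (\<Sum>m\<in>UNIV. partial k (\<lambda>z. H z $ i $ m) x * K x $ m $ j + H x $ i $ m * partial k (\<lambda>z. K z $ m $ j) x)" for i j k
    unfolding matrix_nth using assms by (simp add: partial_sum partial_mult differentiable_mult)
  then show ?thesis
    by (simp add: vec_eq_iff along_def matrix_nth sum_3 algebra_simps)
qed

lemma along_add:
  assumes "\<And>i j. (\<lambda>y. H y $ i $ j) differentiable (at x)" "\<And>i j. (\<lambda>y. K y $ i $ j) differentiable (at x)"
  shows "along X (\<lambda>y. H y + K y) x = along X H x + along X K x"
  using assms by (simp add: vec_eq_iff along_def partial_add sum.distrib algebra_simps)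

lemma along_scaleR:
  assumes "\<And>i j. (\<lambda>y. H y $ i $ j) differentiable (at x)"
  shows "along X (\<lambda>y. k *\<^sub>R H y) x = k *\<^sub>R along X H x"
  using assms by (simp add: vec_eq_iff along_def partial_cmult sum_distrib_left algebra_simps)

lemma along_outer:
  assumes "\<And>i. (\<lambda>y. a y $ i) differentiable (at x)" "\<And>i. (\<lambda>y. b y $ i) differentiable (at x)"
  shows "along X (\<lambda>y. outer (a y) (b y)) x = outer (along_vec X a x) (b x) + outer (a x) (along_vec X b x)"
  using assms by (simp add: vec_eq_iff along_def along_vec_def partial_mult sum_3 algebra_simps)

lemma along_local:
  assumes "open U" "x \<in> U" "\<And>y. y \<in> U \<Longrightarrow> H y = K y"
  shows "along X H x = along X K x"
proof -
  have "partial k (\<lambda>z. H z $ i $ j) x = partial k (\<lambda>z. K z $ i $ j) x" for i j k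
    using assms by (intro partial_local[OF assms(1,2)]) simp
  then show ?thesis by (simp add: along_def)
qed

lemma trace_along:
  assumes "\<And>i j. (\<lambda>y. H y $ i $ j) differentiable (at x)"
  shows "trace (along X H x) = (\<Sum>k\<in>UNIV. X x $ k * partial k (\<lambda>y. trace (H y)) x)"
  using assms by (simp add: trace_def along_def sum_3 partial_add differentiable_add algebra_simps)

lemma transpose_lie:
  assumes "open U" "x \<in> U" "\<And>y. y \<in> U \<Longrightarrow> transpose (G y) = G y"
  shows "transpose (lie X G x) = lie X G x"
proof -
  have "G y $ i $ j = G y $ j $ i" if "y \<in> U" for i j y
    using arg_cong[OF assms(3)[OF that], of "\<lambda>M. M $ j $ i"] by (simp add: transpose_def)
  then have sym: "partial k (\<lambda>z. G z $ i $ j) x = partial k (\<lambda>z. G z $ j $ i) x" for i j k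
    using partial_local[OF assms(1,2), of "\<lambda>z. G z $ i $ j" "\<lambda>z. G z $ j $ i"] by blast
  have "along X G x $ j $ i = along X G x $ i $ j" for i j
    unfolding along_def vec_lambda_beta by (intro sum.cong refl arg_cong2[of _ _ _ _ times] sym)
  then have "transpose (along X G x) = along X G x"
    by (simp add: transpose_def vec_eq_iff)
  then show ?thesis
    using assms(2,3) by (simp add: lie_def transpose_add matrix_transpose_mul add_ac)
qed

lemma matrix_vec_nth: "((M::real^3^3) *v v) $ i = (\<Sum>k\<in>UNIV. M $ i $ k * v $ k)"
  by (simp add: matrix_vector_mult_def)

lemma partial_constant_on:
  assumes "open U" "x \<in> U" "\<And>y. y \<in> U \<Longrightarrow> f y = r"
  shows "partial i f x = 0"
  using partial_local[OF assms(1,2), of f "\<lambda>y. r"] assms(3) by simp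

section \<open>A compatible metric in coordinates\<close>

text \<open>The component functions, in one chart, of a compatible metric \<open>G\<close>, its contact form \<open>a\<close>, its Reeb
  field \<open>X\<close> and the complex structure \<open>\<Phi>\<close> extended by zero on \<open>X\<close>. The algebraic relations are
  required on an open set, and not at a single point, because they are going to be differentiated.\<close>

locale compatible_coords =
  fixes U :: "(real^3) set" and \<theta> :: real
    and G :: "real^3 \<Rightarrow> real^3^3" and a X :: "real^3 \<Rightarrow> real^3" and \<Phi> :: "real^3 \<Rightarrow> real^3^3"
  assumes open_U: "open U" and \<theta>_pos: "\<theta> > 0"
    and smooth_G: "smooth_on U (\<lambda>y. G y $ i $ j)"
    and smooth_a: "smooth_on U (\<lambda>y. a y $ i)"
    and smooth_X: "smooth_on U (\<lambda>y. X y $ i)"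
    and smooth_\<Phi>: "smooth_on U (\<lambda>y. \<Phi> y $ i $ j)"
    and invertible_G: "y \<in> U \<Longrightarrow> invertible (G y)"
    and sym_G: "y \<in> U \<Longrightarrow> transpose (G y) = G y"
    and G_X: "y \<in> U \<Longrightarrow> G y *v X y = a y"
    and a_X: "y \<in> U \<Longrightarrow> a y \<bullet> X y = 1"
    and F_X: "y \<in> U \<Longrightarrow> exterior a y *v X y = 0"
    and \<Phi>_\<Phi>: "y \<in> U \<Longrightarrow> \<Phi> y ** \<Phi> y = outer (X y) (a y) - mat 1"
    and a_\<Phi>: "y \<in> U \<Longrightarrow> a y v* \<Phi> y = 0"
    and G_eq: "y \<in> U \<Longrightarrow> G y = (1 / \<theta>) *\<^sub>R (exterior a y ** \<Phi> y) + outer (a y) (a y)"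
begin

lemma diff_G: "y \<in> U \<Longrightarrow> (\<lambda>y. G y $ i $ j) differentiable (at y)"
  and diff_a: "y \<in> U \<Longrightarrow> (\<lambda>y. a y $ i) differentiable (at y)"
  and diff_X: "y \<in> U \<Longrightarrow> (\<lambda>y. X y $ i) differentiable (at y)"
  and diff_\<Phi>: "y \<in> U \<Longrightarrow> (\<lambda>y. \<Phi> y $ i $ j) differentiable (at y)"
  and diff_pG: "y \<in> U \<Longrightarrow> partial k (\<lambda>y. G y $ i $ j) differentiable (at y)"
  and diff_pa: "y \<in> U \<Longrightarrow> partial k (\<lambda>y. a y $ i) differentiable (at y)"
  and diff_pX: "y \<in> U \<Longrightarrow> partial k (\<lambda>y. X y $ i) differentiable (at y)"
  by (blast intro: smooth_on_differentiable[OF _ open_U] smooth_on_partial smooth_G smooth_a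
      smooth_X smooth_\<Phi>)+

lemma diff_F: "y \<in> U \<Longrightarrow> (\<lambda>y. exterior a y $ i $ j) differentiable (at y)"
  unfolding exterior_nth by (intro differentiable_diff diff_pa)

lemma diff_inv: "y \<in> U \<Longrightarrow> (\<lambda>y. matrix_inv (G y) $ i $ j) differentiable (at y)"
  using differentiable_matrix_inv[OF open_U _ invertible_G diff_G] by blast

lemma diff_christoffel: "y \<in> U \<Longrightarrow> christoffel_of G k i j differentiable (at y)"
  unfolding christoffel_of_def[abs_def]
  by (intro differentiable_mult differentiable_const differentiable_sum differentiable_add
      differentiable_diff diff_inv diff_pG ballI) auto

lemma diff_nabla: "y \<in> U \<Longrightarrow> (\<lambda>y. nabla G X y $ l $ i) differentiable (at y)"
  unfolding nabla_def vec_lambda_beta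
  by (intro differentiable_mult differentiable_sum differentiable_add diff_X
      diff_pX diff_christoffel ballI) auto

lemma G_sym: "y \<in> U \<Longrightarrow> G y $ i $ j = G y $ j $ i"
  using arg_cong[OF sym_G, of y "\<lambda>M. M $ j $ i"] by (simp add: transpose_def)

lemma partial_G_sym: "y \<in> U \<Longrightarrow> partial k (\<lambda>z. G z $ i $ j) y = partial k (\<lambda>z. G z $ j $ i) y"
  using partial_local[OF open_U, of y "\<lambda>z. G z $ i $ j" "\<lambda>z. G z $ j $ i"] G_sym by blast

lemma sym_inv: "y \<in> U \<Longrightarrow> transpose (matrix_inv (G y)) = matrix_inv (G y)"
  using transpose_matrix_inv invertible_G sym_G by blast

lemma sym_lie: "y \<in> U \<Longrightarrow> transpose (lie X G y) = lie X G y"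
  using transpose_lie[OF open_U, of y G X] sym_G by blast

text \<open>Cartan's formula: \<open>X\<close> preserves the contact form, because \<open>a(X)\<close> is constant and the
  contraction of \<open>X\<close> with the exterior derivative vanishes.\<close>

lemma lie_a:
  assumes y: "y \<in> U"
  shows "along_vec X a y + transpose (grad X y) *v a y = 0"
proof -
  have "(along_vec X a y + transpose (grad X y) *v a y) $ m = 0" for m
  proof -
    have "partial m (\<lambda>z. \<Sum>k\<in>UNIV. a z $ k * X z $ k) y = 0"
      using partial_constant_on[OF open_U y, of "\<lambda>z. \<Sum>k\<in>UNIV. a z $ k * X z $ k" 1] a_X
      by (simp add: inner_vec_def)
    then have 1: "(\<Sum>k\<in>UNIV. partial m (\<lambda>z. a z $ k) y * X y $ k + a y $ k * partial m (\<lambda>z. X z $ k) y) = 0"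
      by (simp add: partial_sum partial_mult differentiable_mult diff_a diff_X y)
    have 2: "(\<Sum>k\<in>UNIV. (partial m (\<lambda>z. a z $ k) y - partial k (\<lambda>z. a z $ m) y) * X y $ k) = 0"
      using arg_cong[OF F_X[OF y], of "\<lambda>v. v $ m"] by (simp add: matrix_vec_nth exterior_nth)
    show ?thesis
      using 1 2 by (simp add: along_vec_def matrix_vec_nth transpose_def grad_nth sum_3 algebra_simps)
  qed
  then show ?thesis by (simp add: vec_eq_iff)
qed

text \<open>Differentiate the vanishing contraction of \<open>X\<close> with the exterior derivative \<open>F\<close> of \<open>a\<close>, and use that \<open>F\<close> is
  closed.\<close>

lemma lie_F:
  assumes y: "y \<in> U"
  shows "lie X (exterior a) y = 0"
proof -
  let ?F = "\<lambda>i j y. exterior a y $ i $ j"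
  have FX: "(\<Sum>k\<in>UNIV. ?F i k z * X z $ k) = 0" if "z \<in> U" for i z
    using arg_cong[OF F_X[OF that], of "\<lambda>v. v $ i"] by (simp add: matrix_vec_nth)
  have dFX: "(\<Sum>k\<in>UNIV. partial j (?F i k) y * X y $ k + ?F i k y * partial j (\<lambda>z. X z $ k) y) = 0" for i j
    using partial_constant_on[OF open_U y, of "\<lambda>z. \<Sum>k\<in>UNIV. ?F i k z * X z $ k" 0 j] FX
    by (simp add: partial_sum partial_mult differentiable_mult diff_F diff_X y)
  have pc: "partial i (partial j (\<lambda>z. a z $ k)) y = partial j (partial i (\<lambda>z. a z $ k)) y" for i j k
    by (rule partial_commute[OF smooth_a open_U y])
  have closed: "partial k (?F i j) y + partial i (?F j k) y = partial j (?F i k) y" for i j k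
    using pc[of k i j] pc[of k j i] pc[of i j k] by (simp add: exterior_nth partial_diff diff_pa y)
  have skew: "?F k j y = - ?F j k y" for j k by (simp add: exterior_nth)
  have "lie X (exterior a) y $ i $ j = 0" for i j
  proof -
    have "(\<Sum>k\<in>UNIV. X y $ k * (partial k (?F i j) y + partial i (?F j k) y))
        = (\<Sum>k\<in>UNIV. X y $ k * partial j (?F i k) y)" by (simp add: closed)
    with dFX[of j i] dFX[of i j] show ?thesis
      by (simp add: lie_def along_def matrix_nth transpose_def grad_nth sum_3 skew[of _ j] algebra_simps)
  qed
  then show ?thesis by (simp add: vec_eq_iff)
qed

lemma G_\<Phi>: "y \<in> U \<Longrightarrow> G y ** \<Phi> y = - (1 / \<theta>) *\<^sub>R exterior a y"
  using G_eq[of y] \<Phi>_\<Phi>[of y] a_\<Phi>[of y] F_X[of y]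
  by (simp add: matrix_ring outer_mult mult_outer flip: matrix_mul_assoc)

text \<open>This relation, a consequence of \<open>\<Phi>\<close> squaring to minus the identity on the contact plane, eliminates
  the inverse of \<open>G\<close> from the formulas below.\<close>

lemma inv_F:
  assumes "y \<in> U"
  shows "matrix_inv (G y) ** exterior a y = - \<theta> *\<^sub>R \<Phi> y"
proof -
  have "exterior a y = - \<theta> *\<^sub>R (G y ** \<Phi> y)"
    using G_\<Phi>[OF assms] \<theta>_pos by simp
  then show ?thesis
    by (simp add: matrix_ring matrix_inv_inverse invertible_G assms)
qed

lemma trace_\<Phi>_\<Phi>: "y \<in> U \<Longrightarrow> trace (\<Phi> y ** \<Phi> y) = -2"
  using a_X[of y] by (simp add: \<Phi>_\<Phi> trace_sub trace_I trace_outer inner_commute)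

lemma trace_\<Phi>: "y \<in> U \<Longrightarrow> trace (\<Phi> y) = 0"
  using trace_symmetric_skew(1)[OF sym_inv sym_lie transpose_exterior[of a y], of y y] \<theta>_pos
  by (simp add: inv_F trace_scaleR trace_minus)

text \<open>The Lie derivative of \<open>G = (1 / \<theta>) F \<Phi> + a \<otimes> a\<close> is \<open>(1 / \<theta>) F\<close> times the Lie derivative of \<open>\<Phi>\<close>, because
  those of \<open>F\<close> and of \<open>a\<close> vanish.\<close>

lemma lie_G:
  assumes y: "y \<in> U"
  shows "lie X G y = (1 / \<theta>) *\<^sub>R (exterior a y ** (along X \<Phi> y - grad X y ** \<Phi> y + \<Phi> y ** grad X y))"
proof -
  let ?F = "exterior a y" and ?P = "grad X y" and ?a = "a y" and ?b = "along_vec X a y"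
  have "along X G y = along X (\<lambda>y. (1 / \<theta>) *\<^sub>R (exterior a y ** \<Phi> y) + outer (a y) (a y)) y"
    by (rule along_local[OF open_U y G_eq])
  also have "\<dots> = (1 / \<theta>) *\<^sub>R along X (\<lambda>y. exterior a y ** \<Phi> y) y + along X (\<lambda>y. outer (a y) (a y)) y"
    by (subst along_add)
      (auto simp: matrix_nth along_scaleR y diff_F diff_\<Phi> diff_a differentiable_mult differentiable_sum
          simp flip: times_divide_eq_left)
  also have "\<dots> = (1 / \<theta>) *\<^sub>R (along X (exterior a) y ** \<Phi> y + ?F ** along X \<Phi> y) + (outer ?b ?a + outer ?a ?b)"
    by (simp add: along_mult along_outer y diff_F diff_\<Phi> diff_a)
  finally have 1: "along X G y = \<dots>" .
  have 2: "along X (exterior a) y = - (transpose ?P ** ?F) - ?F ** ?P"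
    using lie_F[OF y, unfolded lie_def] by (simp add: eq_diff_eq eq_neg_iff_add_eq_0 add_ac)
  have 3: "?b = - (transpose ?P *v ?a)"
    using lie_a[OF y] by (simp add: add_eq_0_iff2)
  have 4: "outer (- u) v = - outer u v" "outer v (- u) = - outer v u" for u v
    by (simp_all add: vec_eq_iff)
  have 5: "?a v* ?P = transpose ?P *v ?a" by simp
  show ?thesis
    unfolding lie_def 1 2 3 4 G_eq[OF y]
    by (simp add: matrix_ring mult_outer outer_mult algebra_simps)
qed

text \<open>The Reeb flow preserves volume. After raising an index, the Lie derivative of \<open>G\<close> is \<open>- \<Phi>\<close> times the
  Lie derivative of \<open>\<Phi>\<close>, and the trace of this product is minus half the derivative along \<open>X\<close> of the
  constant \<open>tr (\<Phi> \<Phi>)\<close>.\<close>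

lemma trace_inv_lie:
  assumes y: "y \<in> U"
  shows "trace (matrix_inv (G y) ** lie X G y) = 0"
proof -
  let ?P = "grad X y"
  have "0 = (\<Sum>k\<in>UNIV. X y $ k * partial k (\<lambda>z. trace (\<Phi> z ** \<Phi> z)) y)"
    using partial_constant_on[OF open_U y trace_\<Phi>_\<Phi>] by simp
  also have "\<dots> = trace (along X (\<lambda>z. \<Phi> z ** \<Phi> z) y)"
    by (rule trace_along[symmetric])
       (auto simp: matrix_nth y diff_\<Phi> intro!: differentiable_mult differentiable_sum)
  also have "\<dots> = trace (along X \<Phi> y ** \<Phi> y) + trace (\<Phi> y ** along X \<Phi> y)"
    by (simp add: along_mult diff_\<Phi> y trace_add)
  finally have 1: "trace (\<Phi> y ** along X \<Phi> y) = 0"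
    by (simp add: trace_mul_sym[of "along X \<Phi> y"])
  have 2: "trace (\<Phi> y ** ?P ** \<Phi> y) = trace (\<Phi> y ** \<Phi> y ** ?P)"
    using trace_mul_sym[of "\<Phi> y ** ?P" "\<Phi> y"] by (simp add: matrix_mul_assoc)
  have "matrix_inv (G y) ** lie X G y = (1 / \<theta>) *\<^sub>R (matrix_inv (G y) ** exterior a y
      ** (along X \<Phi> y - ?P ** \<Phi> y + \<Phi> y ** ?P))"
    by (simp add: lie_G[OF y] matrix_scaleR_right matrix_mul_assoc)
  also have "\<dots> = - (\<Phi> y ** along X \<Phi> y - \<Phi> y ** ?P ** \<Phi> y + \<Phi> y ** \<Phi> y ** ?P)"
    using \<theta>_pos by (simp add: inv_F[OF y] matrix_ring algebra_simps)
  also have "trace \<dots> = 0"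
    by (simp add: trace_minus trace_add trace_sub 1 2)
  finally show ?thesis .
qed

text \<open>Lowering the upper index gives the Christoffel symbols of the first kind.\<close>

lemma G_christoffel:
  assumes y: "y \<in> U"
  shows "(\<Sum>l\<in>UNIV. G y $ m $ l * christoffel_of G l i j y) = (1/2) * (partial i (\<lambda>z. G z $ j $ m) y
    + partial j (\<lambda>z. G z $ i $ m) y - partial m (\<lambda>z. G z $ i $ j) y)"
proof -
  define v where "v = (\<chi> l. (1/2) * (partial i (\<lambda>z. G z $ j $ l) y
    + partial j (\<lambda>z. G z $ i $ l) y - partial l (\<lambda>z. G z $ i $ j) y))"
  have "(\<chi> l. christoffel_of G l i j y) = matrix_inv (G y) *v v"
    by (simp add: vec_eq_iff christoffel_of_def matrix_vec_nth v_def sum_distrib_left mult_ac)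
  then have "G y *v (\<chi> l. christoffel_of G l i j y) = v"
    by (simp add: matrix_vector_mul_assoc matrix_inv_inverse invertible_G y)
  from arg_cong[OF this, of "\<lambda>w. w $ m"] show ?thesis
    by (simp add: matrix_vec_nth v_def)
qed

text \<open>Since \<open>a\<close> is the form dual to \<open>X\<close>, the symmetric part of its covariant derivative is half the Lie
  derivative of the metric, and the skew part is half the exterior derivative of \<open>a\<close>. The minus sign
  arises because the column index of \<open>nabla\<close> is the direction of differentiation.\<close>

lemma G_nabla:
  assumes y: "y \<in> U"
  shows "2 *\<^sub>R (G y ** nabla G X y) = lie X G y - exterior a y"
proof -
  have "2 * (G y ** nabla G X y) $ m $ i = lie X G y $ m $ i - exterior a y $ m $ i" for m i
  proof -
    have da: "partial i (\<lambda>z. a z $ m) y = (\<Sum>k\<in>UNIV. partial i (\<lambda>z. G z $ m $ k) y * X y $ k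
        + G y $ m $ k * partial i (\<lambda>z. X z $ k) y)" for i m
    proof -
      have "a z $ m = (\<Sum>k\<in>UNIV. G z $ m $ k * X z $ k)" if "z \<in> U" for z
        using arg_cong[OF G_X[OF that], of "\<lambda>v. v $ m"] by (simp add: matrix_vec_nth)
      from partial_local[OF open_U y this]
      show ?thesis
        by (simp add: partial_sum partial_mult differentiable_mult diff_G diff_X y)
    qed
    have "(G y ** nabla G X y) $ m $ i = (\<Sum>l\<in>UNIV. G y $ m $ l * partial i (\<lambda>z. X z $ l) y)
       + (\<Sum>k\<in>UNIV. X y $ k * (\<Sum>l\<in>UNIV. G y $ m $ l * christoffel_of G l i k y))"
      by (simp add: matrix_nth nabla_def sum_3 algebra_simps)
    then have "2 * (G y ** nabla G X y) $ m $ i = 2 * ((\<Sum>l\<in>UNIV. G y $ m $ l * partial i (\<lambda>z. X z $ l) y)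
       + (\<Sum>k\<in>UNIV. X y $ k * (\<Sum>l\<in>UNIV. G y $ m $ l * christoffel_of G l i k y)))" by simp
    also have "\<dots> = 2 * (\<Sum>l\<in>UNIV. G y $ m $ l * partial i (\<lambda>z. X z $ l) y)
       + (\<Sum>k\<in>UNIV. X y $ k * (partial i (\<lambda>z. G z $ k $ m) y
        + partial k (\<lambda>z. G z $ i $ m) y - partial m (\<lambda>z. G z $ i $ k) y))"
      by (simp add: G_christoffel[OF y] sum_3 algebra_simps)
    also have "\<dots> = (\<Sum>k\<in>UNIV. 2 * (G y $ m $ k * partial i (\<lambda>z. X z $ k) y) + X y $ k * (partial i (\<lambda>z. G z $ k $ m) y
        + partial k (\<lambda>z. G z $ i $ m) y - partial m (\<lambda>z. G z $ i $ k) y))"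
      by (simp only: sum.distrib sum_distrib_left)
    also have "\<dots> = (\<Sum>k\<in>UNIV. X y $ k * partial k (\<lambda>z. G z $ m $ i) y
        + partial m (\<lambda>z. X z $ k) y * G y $ k $ i + G y $ m $ k * partial i (\<lambda>z. X z $ k) y
        - (partial m (\<lambda>z. G z $ i $ k) y * X y $ k + G y $ i $ k * partial m (\<lambda>z. X z $ k) y
          - (partial i (\<lambda>z. G z $ m $ k) y * X y $ k + G y $ m $ k * partial i (\<lambda>z. X z $ k) y)))"
      (is "_ = ?R")
    proof (intro sum.cong refl)
      fix k
      show "2 * (G y $ m $ k * partial i (\<lambda>z. X z $ k) y) + X y $ k * (partial i (\<lambda>z. G z $ k $ m) y
        + partial k (\<lambda>z. G z $ i $ m) y - partial m (\<lambda>z. G z $ i $ k) y)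
        = X y $ k * partial k (\<lambda>z. G z $ m $ i) y
        + partial m (\<lambda>z. X z $ k) y * G y $ k $ i + G y $ m $ k * partial i (\<lambda>z. X z $ k) y
        - (partial m (\<lambda>z. G z $ i $ k) y * X y $ k + G y $ i $ k * partial m (\<lambda>z. X z $ k) y
          - (partial i (\<lambda>z. G z $ m $ k) y * X y $ k + G y $ m $ k * partial i (\<lambda>z. X z $ k) y))"
        unfolding partial_G_sym[OF y, of i k m] partial_G_sym[OF y, of k i m] G_sym[OF y, of k i]
        by algebra
    qed
    also have "?R = lie X G y $ m $ i - exterior a y $ m $ i"
      by (simp only: lie_def along_def matrix_nth transpose_def grad_nth exterior_nth da
          vector_add_component vec_lambda_beta sum.distrib sum_subtractf)
    finally show ?thesis .
  qed
  then show ?thesis by (simp add: vec_eq_iff)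
qed

lemma nabla_eq:
  assumes y: "y \<in> U"
  shows "nabla G X y = (1/2) *\<^sub>R (matrix_inv (G y) ** lie X G y + \<theta> *\<^sub>R \<Phi> y)"
proof -
  have "2 *\<^sub>R nabla G X y = matrix_inv (G y) ** (2 *\<^sub>R (G y ** nabla G X y))"
    by (simp add: matrix_ring matrix_inv_inverse invertible_G y)
  also have "\<dots> = matrix_inv (G y) ** lie X G y + \<theta> *\<^sub>R \<Phi> y"
    by (simp add: G_nabla[OF y] matrix_ring inv_F y)
  finally have "(1/2) *\<^sub>R (2 *\<^sub>R nabla G X y) = (1/2) *\<^sub>R (matrix_inv (G y) ** lie X G y + \<theta> *\<^sub>R \<Phi> y)"
    by simp
  then show ?thesis by simp
qed

lemma trace_nabla: "y \<in> U \<Longrightarrow> trace (nabla G X y) = 0"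
  by (simp add: nabla_eq trace_scaleR trace_add trace_inv_lie trace_\<Phi>)

text \<open>In the square of \<open>nabla_eq\<close> the mixed term is a symmetric form paired with a skew one, so its trace
  vanishes, and the skew part contributes \<open>(\<theta>\<^sup>2 / 4) tr (\<Phi> \<Phi>)\<close>.\<close>

lemma trace_nabla_square:
  assumes y: "y \<in> U"
  shows "trace (nabla G X y ** nabla G X y) = torsion G X y / 4 - \<theta>\<^sup>2 / 2"
proof -
  let ?S = "matrix_inv (G y) ** lie X G y"
  have "trace (?S ** (- \<theta> *\<^sub>R \<Phi> y)) = 0"
    using trace_symmetric_skew(2)[OF sym_inv sym_lie transpose_exterior[of a y], of y y] y
    by (simp only: inv_F)
  then have SP: "trace (?S ** \<Phi> y) = 0"
    using \<theta>_pos by (simp add: matrix_ring trace_scaleR trace_minus)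
  then have PS: "trace (\<Phi> y ** ?S) = 0" by (simp add: trace_mul_sym[of "\<Phi> y"])
  show ?thesis
    using SP PS
    by (simp add: nabla_eq[OF y] matrix_add_ldistrib matrix_add_rdistrib matrix_scaleR_left
        matrix_scaleR_right trace_scaleR trace_add trace_\<Phi>_\<Phi>[OF y] torsion_def power2_eq_square algebra_simps)
qed

text \<open>Contracting the Lie derivative of \<open>G\<close> with \<open>X\<close> gives the Lie derivative of the dual form \<open>a\<close>.\<close>

lemma lie_G_X:
  assumes y: "y \<in> U"
  shows "lie X G y *v X y = 0"
proof -
  have "(lie X G y *v X y) $ m = (along_vec X a y + transpose (grad X y) *v a y) $ m" for m
  proof -
    have am: "a z $ m = (\<Sum>k\<in>UNIV. G z $ m $ k * X z $ k)" if "z \<in> U" for z m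
      using arg_cong[OF G_X[OF that], of "\<lambda>v. v $ m"] by (simp add: matrix_vec_nth)
    have da: "partial i (\<lambda>z. a z $ m) y = (\<Sum>k\<in>UNIV. partial i (\<lambda>z. G z $ m $ k) y * X y $ k
        + G y $ m $ k * partial i (\<lambda>z. X z $ k) y)" for i
      using partial_local[OF open_U y am]
      by (simp add: partial_sum partial_mult differentiable_mult diff_G diff_X y)
    show ?thesis
      by (simp add: lie_def along_def along_vec_def matrix_nth matrix_vec_nth transpose_def grad_nth da
          am[OF y] sum_3 algebra_simps)
  qed
  then show ?thesis using lie_a[OF y] by (simp add: vec_eq_iff)
qed

text \<open>The Reeb orbits are geodesics: \<open>X\<close> is in the kernel of both the symmetric and the skew part of its
  covariant derivative.\<close>

lemma nabla_X:
  assumes y: "y \<in> U"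
  shows "nabla G X y *v X y = 0"
proof -
  have "2 *\<^sub>R (G y *v (nabla G X y *v X y)) = (2 *\<^sub>R (G y ** nabla G X y)) *v X y"
    by (simp add: matrix_vector_mul_assoc scaleR_matrix_vector_assoc)
  also have "\<dots> = 0"
    by (simp add: G_nabla[OF y] lie_G_X F_X y matrix_vector_mult_diff_rdistrib)
  finally have "matrix_inv (G y) *v (G y *v (nabla G X y *v X y)) = 0" by simp
  then show ?thesis
    by (simp add: matrix_vector_mul_assoc matrix_mul_assoc matrix_inv_inverse invertible_G y)
qed

text \<open>The definition of curvature as a commutator of covariant derivatives, applied to \<open>X\<close>; the second
  derivatives of \<open>X\<close> cancel.\<close>

lemma riemann_X:
  assumes y: "y \<in> U"
  shows "(\<Sum>k\<in>UNIV. riemann_of G l i j k y * X y $ k)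
    = partial i (\<lambda>z. nabla G X z $ l $ j) y - partial j (\<lambda>z. nabla G X z $ l $ i) y
      + (\<Sum>m\<in>UNIV. christoffel_of G l i m y * nabla G X y $ m $ j
                - christoffel_of G l j m y * nabla G X y $ m $ i)"
proof -
  have dn: "partial i (\<lambda>z. nabla G X z $ l $ j) y = partial i (partial j (\<lambda>z. X z $ l)) y
      + (\<Sum>k\<in>UNIV. partial i (christoffel_of G l j k) y * X y $ k
          + christoffel_of G l j k y * partial i (\<lambda>z. X z $ k) y)" for i j
    unfolding nabla_def vec_lambda_beta
    by (simp add: partial_add partial_sum partial_mult differentiable_mult differentiable_sum
        diff_christoffel diff_X diff_pX y)
  show ?thesis
    unfolding dn partial_commute[OF smooth_X open_U y, of i j]
    by (simp add: nabla_def riemann_of_def sum_3 algebra_simps)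
qed

lemma christoffel_sym:
  assumes "y \<in> U"
  shows "christoffel_of G k i j y = christoffel_of G k j i y"
  unfolding christoffel_of_def partial_G_sym[OF assms, of _ i j] by (simp add: add_ac)

text \<open>Since \<open>X\<close> is geodesic, \<open>R(u,X)X = - (\<nabla>\<^sub>X A) u - A (A u)\<close> for \<open>A = \<nabla>X\<close>; the trace of the first
  term is the derivative of the divergence of \<open>X\<close>, which vanishes.\<close>

proposition ricci_X:
  assumes x: "x \<in> U"
  shows "(\<Sum>i\<in>UNIV. \<Sum>j\<in>UNIV. \<Sum>k\<in>UNIV. riemann_of G i i j k x * X x $ j * X x $ k)
    = \<theta>\<^sup>2 / 2 - torsion G X x / 4"
proof -
  let ?A = "\<lambda>i j. nabla G X x $ i $ j" and ?\<Gamma> = "\<lambda>k i j. christoffel_of G k i j x"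
  let ?dA = "\<lambda>k i j. partial k (\<lambda>z. nabla G X z $ i $ j) x" and ?X = "\<lambda>j. X x $ j"
  let ?P = "\<lambda>l i. partial i (\<lambda>z. X z $ l) x"
  have AX: "(\<Sum>j\<in>UNIV. nabla G X y $ i $ j * X y $ j) = 0" if "y \<in> U" for y i
    using arg_cong[OF nabla_X[OF that], of "\<lambda>v. v $ i"] by (simp add: matrix_vec_nth)
  have dAX: "(\<Sum>j\<in>UNIV. ?X j * ?dA k i j) = - (\<Sum>j\<in>UNIV. ?A i j * ?P j k)" for i k
    using partial_constant_on[OF open_U x, of "\<lambda>y. \<Sum>j\<in>UNIV. nabla G X y $ i $ j * X y $ j" 0 k] AX
    by (simp add: partial_sum partial_mult differentiable_mult diff_nabla diff_X x sum.distrib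
        mult.commute eq_neg_iff_add_eq_0)
  have dtr: "(\<Sum>i\<in>UNIV. ?dA j i i) = 0" for j
    using partial_constant_on[OF open_U x, of "\<lambda>y. trace (nabla G X y)" 0 j] trace_nabla
    by (simp add: trace_def partial_sum diff_nabla x)
  have "(\<Sum>i\<in>UNIV. \<Sum>j\<in>UNIV. \<Sum>k\<in>UNIV. riemann_of G i i j k x * ?X j * ?X k)
    = (\<Sum>i\<in>UNIV. \<Sum>j\<in>UNIV. ?X j * (\<Sum>k\<in>UNIV. riemann_of G i i j k x * ?X k))"
    by (simp add: sum_distrib_left mult_ac)
  also have "\<dots> = (\<Sum>i\<in>UNIV. \<Sum>j\<in>UNIV. ?X j * (?dA i i j - ?dA j i i
      + (\<Sum>m\<in>UNIV. ?\<Gamma> i i m * ?A m j - ?\<Gamma> i j m * ?A m i)))"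
    unfolding riemann_X[OF x] ..
  also have "\<dots> = (\<Sum>i\<in>UNIV. \<Sum>j\<in>UNIV. ?X j * ?dA i i j) - (\<Sum>j\<in>UNIV. ?X j * (\<Sum>i\<in>UNIV. ?dA j i i))
      + (\<Sum>i\<in>UNIV. \<Sum>m\<in>UNIV. ?\<Gamma> i i m * (\<Sum>j\<in>UNIV. ?A m j * ?X j))
      - (\<Sum>i\<in>UNIV. \<Sum>j\<in>UNIV. \<Sum>m\<in>UNIV. ?X j * ?\<Gamma> i j m * ?A m i)"
    by (simp add: sum_3 algebra_simps)
  also have "\<dots> = - (\<Sum>i\<in>UNIV. \<Sum>j\<in>UNIV. ?A i j * ?P j i)
      - (\<Sum>i\<in>UNIV. \<Sum>j\<in>UNIV. \<Sum>m\<in>UNIV. ?X j * ?\<Gamma> i j m * ?A m i)"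
    unfolding dAX dtr AX[OF x] by (simp add: sum_negf)
  also have "\<dots> = - trace (nabla G X x ** nabla G X x)"
  proof -
    have "?A j i = ?P j i + (\<Sum>k\<in>UNIV. ?\<Gamma> j k i * ?X k)" for i j
      by (simp add: nabla_def christoffel_sym[OF x, of _ i])
    then have "trace (nabla G X x ** nabla G X x)
        = (\<Sum>i\<in>UNIV. \<Sum>j\<in>UNIV. ?A i j * (?P j i + (\<Sum>k\<in>UNIV. ?\<Gamma> j k i * ?X k)))"
      unfolding trace_def matrix_nth by simp
    then show ?thesis by (simp add: sum_3 algebra_simps)
  qed
  finally show ?thesis by (simp add: trace_nabla_square x)
qed

end

section \<open>Pulling back tensors\<close>

text \<open>The derivative of the pulled back components contains second derivatives of \<open>T\<close>, which disappear upon
  antisymmetrization.\<close>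

lemma exterior_pullback:
  fixes T :: "real^3 \<Rightarrow> real^3" and a b :: "real^3 \<Rightarrow> real^3"
  assumes W: "open W" "x \<in> W" and T: "\<And>i. smooth_on W (\<lambda>y. T y $ i)"
    and b: "\<And>i. (\<lambda>y. b y $ i) differentiable (at (T x))"
    and a: "\<And>y. y \<in> W \<Longrightarrow> a y = transpose (grad T y) *v b (T y)"
  shows "exterior a x = transpose (grad T x) ** exterior b (T x) ** grad T x"
proof -
  have dT: "(\<lambda>y. T y $ m) differentiable (at x)" "partial i (\<lambda>y. T y $ m) differentiable (at x)" for m i
    using smooth_on_differentiable[OF _ W] T smooth_on_partial by blast+
  have db: "(\<lambda>y. b (T y) $ m) differentiable (at x)" for m
    using differentiable_chain[of T x "\<lambda>y. b y $ m"] dT b by blast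
  have comm: "partial i (partial j (\<lambda>y. T y $ m)) x = partial j (partial i (\<lambda>y. T y $ m)) x" for i j m
    by (rule partial_commute[OF T W])
  have da: "partial i (\<lambda>y. a y $ j) x = (\<Sum>m\<in>UNIV. partial i (partial j (\<lambda>y. T y $ m)) x * b (T x) $ m
      + partial j (\<lambda>y. T y $ m) x * (\<Sum>n\<in>UNIV. partial i (\<lambda>y. T y $ n) x * partial n (\<lambda>y. b y $ m) (T x)))" for i j
  proof -
    have aj: "a y $ j = (\<Sum>m\<in>UNIV. partial j (\<lambda>z. T z $ m) y * b (T y) $ m)" if "y \<in> W" for y
      by (simp add: a[OF that] matrix_vec_nth transpose_def grad_nth)
    have "partial i (\<lambda>y. b (T y) $ m) x = (\<Sum>n\<in>UNIV. partial i (\<lambda>y. T y $ n) x * partial n (\<lambda>y. b y $ m) (T x))" for m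
      using partial_chain[of T x "\<lambda>y. b y $ m"] dT b by blast
    moreover have "partial i (\<lambda>y. a y $ j) x = partial i (\<lambda>y. \<Sum>m\<in>UNIV. partial j (\<lambda>z. T z $ m) y * b (T y) $ m) x"
      by (rule partial_local[OF W aj])
    ultimately show ?thesis
      by (simp add: partial_sum partial_mult differentiable_mult dT db)
  qed
  have "exterior a x $ i $ j = (transpose (grad T x) ** exterior b (T x) ** grad T x) $ i $ j" for i j
    unfolding exterior_nth[of a] da comm[of j i]
    by (simp add: matrix_nth transpose_def grad_nth exterior_nth sum_3 algebra_simps)
  then show ?thesis by (simp add: vec_eq_iff)
qed

text \<open>Differentiating the pulled back metric and the relation between the two vector fields produces the
  derivative of the Jacobian of \<open>T\<close> along \<open>X\<close>; by the symmetry of second derivatives the two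
  contributions cancel.\<close>

lemma lie_pullback:
  fixes T :: "real^3 \<Rightarrow> real^3"
  assumes W: "open W" "x \<in> W" and T: "\<And>i. smooth_on W (\<lambda>y. T y $ i)"
    and X: "\<And>i. (\<lambda>y. X y $ i) differentiable (at x)"
    and Y: "\<And>i. (\<lambda>y. Y y $ i) differentiable (at (T x))"
    and H: "\<And>i j. (\<lambda>y. H y $ i $ j) differentiable (at (T x))"
    and XY: "\<And>y. y \<in> W \<Longrightarrow> Y (T y) = grad T y *v X y"
    and GH: "\<And>y. y \<in> W \<Longrightarrow> G y = transpose (grad T y) ** H (T y) ** grad T y"
  shows "lie X G x = transpose (grad T x) ** lie Y H (T x) ** grad T x"
proof -
  let ?P = "grad T x" and ?D = "along X (grad T) x"
  have dT: "(\<lambda>y. T y $ m) differentiable (at x)" "partial i (\<lambda>y. T y $ m) differentiable (at x)" for m i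
    using smooth_on_differentiable[OF _ W] T smooth_on_partial by blast+
  have dP: "(\<lambda>y. grad T y $ i $ j) differentiable (at x)" "(\<lambda>y. transpose (grad T y) $ i $ j) differentiable (at x)" for i j
    using dT by (simp_all add: grad_nth transpose_def)
  have comm: "partial i (partial j (\<lambda>y. T y $ m)) x = partial j (partial i (\<lambda>y. T y $ m)) x" for i j m
    by (rule partial_commute[OF T W])
  have dH: "(\<lambda>y. H (T y) $ i $ j) differentiable (at x)" for i j
    using differentiable_chain[of T x "\<lambda>y. H y $ i $ j"] dT H by blast
  have chainH: "along X (\<lambda>y. H (T y)) x = along Y H (T x)"
  proof -
    have "partial k (\<lambda>y. H (T y) $ i $ j) x
        = (\<Sum>m\<in>UNIV. partial k (\<lambda>y. T y $ m) x * partial m (\<lambda>y. H y $ i $ j) (T x))" for k i j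
      using partial_chain[of T x "\<lambda>y. H y $ i $ j"] dT H by blast
    then show ?thesis
      by (simp add: vec_eq_iff along_def XY W matrix_vec_nth grad_nth sum_3 algebra_simps)
  qed
  have alongT: "along X (\<lambda>y. transpose (grad T y)) x = transpose ?D"
    by (simp add: vec_eq_iff along_def transpose_def)
  have "along X G x = along X (\<lambda>y. transpose (grad T y) ** H (T y) ** grad T y) x"
    by (rule along_local[OF W GH])
  also have "\<dots> = along X (\<lambda>y. transpose (grad T y) ** H (T y)) x ** ?P
      + transpose ?P ** H (T x) ** ?D"
    by (rule along_mult) (use dP dH in \<open>auto simp: matrix_nth intro!: differentiable_mult differentiable_sum\<close>)
  also have "\<dots> = (transpose ?D ** H (T x) + transpose ?P ** along Y H (T x)) ** ?P
      + transpose ?P ** H (T x) ** ?D"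
    using dP dH by (simp add: along_mult chainH alongT)
  finally have 1: "along X G x = \<dots>" .
  have "(grad Y (T x) ** ?P) $ l $ i = (?D + ?P ** grad X x) $ l $ i" for l i
  proof -
    have Yl: "Y (T y) $ l = (\<Sum>k\<in>UNIV. partial k (\<lambda>z. T z $ l) y * X y $ k)" if "y \<in> W" for y
      by (simp add: XY[OF that] matrix_vec_nth grad_nth)
    have "partial i (\<lambda>y. Y (T y) $ l) x = partial i (\<lambda>y. \<Sum>k\<in>UNIV. partial k (\<lambda>z. T z $ l) y * X y $ k) x"
      by (rule partial_local[OF W Yl])
    then have "partial i (\<lambda>y. Y (T y) $ l) x = (?D + ?P ** grad X x) $ l $ i"
      by (simp add: partial_sum partial_mult differentiable_mult dT X matrix_nth along_def grad_nth comm[of _ i]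
          sum.distrib mult.commute)
    moreover have "partial i (\<lambda>y. Y (T y) $ l) x = (grad Y (T x) ** ?P) $ l $ i"
      using partial_chain[of T x "\<lambda>y. Y y $ l" i] dT Y by (simp add: matrix_nth grad_nth mult.commute)
    ultimately show ?thesis by simp
  qed
  then have 2: "?D = grad Y (T x) ** ?P - ?P ** grad X x"
    by (simp add: vec_eq_iff algebra_simps)
  have 3: "transpose ?D = transpose ?P ** transpose (grad Y (T x)) - transpose (grad X x) ** transpose ?P"
    unfolding 2 by (simp add: vec_eq_iff transpose_def matrix_nth mult.commute)
  show ?thesis
    unfolding lie_def[of X] lie_def[of Y] 1 3 GH[OF W(2)]
    by (simp add: 2 matrix_ring)
qed

lemma inner_pullback:
  fixes P F :: "real^3^3"
  shows "(P *v u) \<bullet> (F *v (P *v v)) = u \<bullet> ((transpose P ** F ** P) *v v)"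
  by (simp only: matrix_vector_mul_assoc[symmetric] dot_lmul_matrix[symmetric] vector_transpose_matrix)

text \<open>The torsion is the trace of the square of an endomorphism, and this endomorphism is
  conjugated by a change of coordinates.\<close>

lemma torsion_pullback:
  fixes P G H :: "real^3^3"
  assumes P: "invertible P" and H: "invertible H"
    and G: "G = transpose P ** H ** P" and B: "B = transpose P ** C ** P"
  shows "trace (matrix_inv G ** B ** (matrix_inv G ** B)) = trace (matrix_inv H ** C ** (matrix_inv H ** C))"
proof -
  let ?Q = "matrix_inv P"
  note [simp] = matrix_inv_inverse[OF P] matrix_inv_inverse[OF H]
  have QT: "transpose ?Q ** transpose P = mat 1" "transpose P ** transpose ?Q = mat 1"
    by (simp_all flip: matrix_transpose_mul)
  have HH: "M ** matrix_inv H ** H = M" "M ** transpose ?Q ** transpose P = M" "M ** P ** ?Q = M" for M :: "real^3^3"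
    using QT by (simp_all flip: matrix_mul_assoc)
  have inv: "?Q ** matrix_inv H ** transpose ?Q ** G = mat 1"
    by (simp add: G matrix_mul_assoc HH)
  then have "invertible G"
    by (simp add: invertible_left_inverse) blast
  then have "matrix_inv G = ?Q ** matrix_inv H ** transpose ?Q ** G ** matrix_inv G"
    by (simp add: inv)
  also have "\<dots> = ?Q ** matrix_inv H ** transpose ?Q"
    by (simp add: matrix_inv_inverse[OF \<open>invertible G\<close>] flip: matrix_mul_assoc)
  finally have S: "matrix_inv G ** B = ?Q ** matrix_inv H ** C ** P"
    by (simp add: B matrix_mul_assoc HH)
  have "trace (matrix_inv G ** B ** (matrix_inv G ** B)) = trace (?Q ** (matrix_inv H ** C ** (matrix_inv H ** C) ** P))"
    by (simp add: S matrix_mul_assoc HH)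
  also have "\<dots> = trace (matrix_inv H ** C ** (matrix_inv H ** C))"
    by (subst trace_mul_sym) (simp add: matrix_mul_assoc HH)
  finally show ?thesis .
qed

section \<open>Charts and tangent vectors\<close>

locale manifold =
  fixes M :: "'a topology" and A :: "'a chart set"
  assumes manifold: "closed_connected_oriented_3_manifold M A"
begin

lemma topspace_eq: "topspace M = points A"
  using manifold by (simp add: closed_connected_oriented_3_manifold_def points_def)

lemma chart_open: "c \<in> A \<Longrightarrow> openin M (dom_of c)" "c \<in> A \<Longrightarrow> open (img_of c)"
  and chart_homeo: "c \<in> A \<Longrightarrow> homeomorphic_map (subtopology M (dom_of c)) (top_of_set (img_of c)) (coord c)"
  using manifold unfolding closed_connected_oriented_3_manifold_def by blast+

lemma dom_subset: "c \<in> A \<Longrightarrow> dom_of c \<subseteq> topspace M"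
  using chart_open(1) openin_subset by blast

lemma coord_inj: "c \<in> A \<Longrightarrow> inj_on (coord c) (dom_of c)"
  using homeomorphic_imp_injective_map[OF chart_homeo, of c] dom_subset[of c]
  by (simp add: Int_absorb1)

lemma coord_inv_coord [simp]: "c \<in> A \<Longrightarrow> p \<in> dom_of c \<Longrightarrow> coord_inv c (coord c p) = p"
  by (simp add: coord_inv_def the_inv_into_f_f coord_inj)

lemma coord_coord_inv [simp]: "c \<in> A \<Longrightarrow> x \<in> img_of c \<Longrightarrow> coord c (coord_inv c x) = x"
  by (simp add: coord_inv_def f_the_inv_into_f coord_inj)

lemma dom_points: "c \<in> A \<Longrightarrow> p \<in> dom_of c \<Longrightarrow> p \<in> points A"
  by (auto simp: points_def)

lemma chart_at: "p \<in> points A \<Longrightarrow> chart_at A p \<in> A" "p \<in> points A \<Longrightarrow> p \<in> dom_of (chart_at A p)"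
  unfolding chart_at_def points_def by (smt (verit) UN_E someI_ex)+

lemma coord_image_open:
  assumes c: "c \<in> A" and V: "openin M V" "V \<subseteq> dom_of c"
  shows "open (coord c ` V)"
proof -
  have "openin (subtopology M (dom_of c)) V"
    using V by (simp add: openin_subtopology) blast
  then have "openin (top_of_set (img_of c)) (coord c ` V)"
    using homeomorphic_imp_open_map[OF chart_homeo[OF c]] by (simp add: open_map_def)
  then show ?thesis using chart_open(2)[OF c] openin_open_trans by blast
qed

definition overlap :: "'a chart \<Rightarrow> 'a chart \<Rightarrow> (real^3) set" where
  "overlap c d = coord c ` (dom_of c \<inter> dom_of d)"

lemma overlap_open: "c \<in> A \<Longrightarrow> d \<in> A \<Longrightarrow> open (overlap c d)"
  unfolding overlap_def by (intro coord_image_open openin_Int chart_open) auto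

lemma transition_smooth: "c \<in> A \<Longrightarrow> d \<in> A \<Longrightarrow> smooth_on (overlap c d) (\<lambda>x. transition c d x $ i)"
  using manifold unfolding closed_connected_oriented_3_manifold_def overlap_def by blast

lemma transition_differentiable:
  "c \<in> A \<Longrightarrow> d \<in> A \<Longrightarrow> x \<in> overlap c d \<Longrightarrow> (\<lambda>x. transition c d x $ i) differentiable (at x)"
  using smooth_on_differentiable[OF transition_smooth overlap_open] by blast

lemma transition_coord [simp]:
  "c \<in> A \<Longrightarrow> p \<in> dom_of c \<Longrightarrow> transition c d (coord c p) = coord d p"
  by (simp add: transition_def)

lemma jacobian_transition:
  "c \<in> A \<Longrightarrow> d \<in> A \<Longrightarrow> x \<in> overlap c d \<Longrightarrow> jacobian (transition c d) (at x) = grad (transition c d) x"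
  by (simp add: vec_eq_iff grad_nth jacobian_partial transition_differentiable)

text \<open>The Jacobian at a point of the manifold, rather than at its coordinates: in this form the chain rule is
  a cocycle identity (\<open>jac_cocycle\<close>).\<close>

definition jac :: "'a chart \<Rightarrow> 'a chart \<Rightarrow> 'a \<Rightarrow> real^3^3" where
  "jac c d p = jacobian (transition c d) (at (coord c p))"

lemma jac_grad: "c \<in> A \<Longrightarrow> d \<in> A \<Longrightarrow> p \<in> dom_of c \<Longrightarrow> p \<in> dom_of d \<Longrightarrow> jac c d p = grad (transition c d) (coord c p)"
  by (simp add: jac_def jacobian_transition overlap_def)

lemma jac_self:
  assumes "c \<in> A" "p \<in> dom_of c"
  shows "jac c c p = mat 1"
proof -
  have "partial j (\<lambda>x. transition c c x $ i) (coord c p) = partial j (\<lambda>x. x $ i) (coord c p)" for i j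
    using assms by (intro partial_local[OF chart_open(2)[OF assms(1)]]) (auto simp: transition_def)
  moreover have "partial j (\<lambda>x::real^3. x $ i) x = axis j 1 $ i" for i j x
    by (rule partial_eqI) (auto intro: derivative_eq_intros bounded_linear.has_derivative[OF bounded_linear_vec_nth])
  ultimately show ?thesis
    using assms by (auto simp: vec_eq_iff jac_grad grad_nth mat_def axis_def)
qed

lemma jac_cocycle:
  assumes "c \<in> A" "d \<in> A" "e \<in> A" "p \<in> dom_of c" "p \<in> dom_of d" "p \<in> dom_of e"
  shows "jac c e p = jac d e p ** jac c d p"
proof -
  let ?W = "coord c ` (dom_of c \<inter> dom_of d \<inter> dom_of e)" and ?x = "coord c p"
  have W: "open ?W" "?x \<in> ?W"
    using assms by (auto intro!: coord_image_open openin_Int chart_open)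
  have "partial j (\<lambda>x. transition c e x $ i) ?x
      = partial j (\<lambda>x. transition d e (transition c d x) $ i) ?x" for i j
    using assms by (intro partial_local[OF W]) auto
  also have "\<dots> i j = (\<Sum>k\<in>UNIV. partial j (\<lambda>x. transition c d x $ k) ?x
      * partial k (\<lambda>x. transition d e x $ i) (coord d p))" for i j
    using assms by (subst partial_chain) (auto intro!: transition_differentiable simp: overlap_def)
  finally show ?thesis
    using assms by (simp add: vec_eq_iff jac_grad grad_nth matrix_nth mult.commute)
qed

lemma jac_invertible:
  assumes "c \<in> A" "d \<in> A" "p \<in> dom_of c" "p \<in> dom_of d"
  shows "invertible (jac c d p)"
proof -
  have "jac d c p ** jac c d p = mat 1" "jac c d p ** jac d c p = mat 1"
    using jac_cocycle[of c d c p] jac_cocycle[of d c d p] assms by (simp_all add: jac_self)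
  then show ?thesis unfolding invertible_def by blast
qed

lemma tangent_space_iff:
  "v \<in> tangent_space A p \<longleftrightarrow> (\<forall>c. \<not> (c \<in> A \<and> p \<in> dom_of c) \<longrightarrow> v c = 0) \<and>
     (\<forall>c\<in>A. \<forall>d\<in>A. p \<in> dom_of c \<inter> dom_of d \<longrightarrow> v d = jac c d p *v v c)"
  by (simp add: tangent_space_def jac_def)

lemma tangent_transition:
  "v \<in> tangent_space A p \<Longrightarrow> c \<in> A \<Longrightarrow> d \<in> A \<Longrightarrow> p \<in> dom_of c \<Longrightarrow> p \<in> dom_of d \<Longrightarrow>
    v d = jac c d p *v v c"
  unfolding tangent_space_iff by blast

lemma tangent_of_tangent:
  assumes "c \<in> A" "p \<in> dom_of c"
  shows "tangent_of A c p w \<in> tangent_space A p"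
  unfolding tangent_space_iff
proof (intro conjI ballI impI allI)
  fix d e assume "d \<in> A" "e \<in> A" "p \<in> dom_of d \<inter> dom_of e"
  then show "tangent_of A c p w e = jac d e p *v tangent_of A c p w d"
    using jac_cocycle[of c d e p] assms
    by (simp add: tangent_of_def matrix_vector_mul_assoc flip: jac_def)
qed (auto simp: tangent_of_def)

lemma tangent_of_comp:
  "c \<in> A \<Longrightarrow> d \<in> A \<Longrightarrow> p \<in> dom_of c \<Longrightarrow> p \<in> dom_of d \<Longrightarrow> tangent_of A c p w d = jac c d p *v w"
  by (simp add: tangent_of_def jac_def)

lemma tangent_of_self [simp]: "c \<in> A \<Longrightarrow> p \<in> dom_of c \<Longrightarrow> tangent_of A c p w c = w"
  by (simp add: tangent_of_comp jac_self)

lemma tangent_eqI: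
  assumes "u \<in> tangent_space A p" "v \<in> tangent_space A p" "c \<in> A" "p \<in> dom_of c" "u c = v c"
  shows "u = v"
  using assms unfolding tangent_space_iff by (metis Int_iff ext)

lemma tangent_lincomb:
  assumes "u \<in> tangent_space A p" "v \<in> tangent_space A p"
  shows "(\<lambda>c. r *\<^sub>R u c + s *\<^sub>R v c) \<in> tangent_space A p"
  unfolding tangent_space_iff
proof (intro conjI ballI impI allI)
  fix d e assume de: "d \<in> A" "e \<in> A" "p \<in> dom_of d \<inter> dom_of e"
  have "u e = jac d e p *v u d" "v e = jac d e p *v v d"
    using assms de tangent_transition by blast+
  then show "r *\<^sub>R u e + s *\<^sub>R v e = jac d e p *v (r *\<^sub>R u d + s *\<^sub>R v d)"
    by (simp only: matrix_vector_right_distrib matrix_vector_mult_scaleR)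
next
  fix d assume d: "\<not> (d \<in> A \<and> p \<in> dom_of d)"
  have "u d = 0" "v d = 0"
    using assms d unfolding tangent_space_iff by blast+
  then show "r *\<^sub>R u d + s *\<^sub>R v d = 0" by simp
qed

lemma tangent_zero: "(\<lambda>c. 0) \<in> tangent_space A p"
  by (simp add: tangent_space_iff)

lemma coord_vector_tangent: "c \<in> A \<Longrightarrow> p \<in> dom_of c \<Longrightarrow> coord_vector A c p i \<in> tangent_space A p"
  by (simp add: coord_vector_def tangent_of_tangent)

lemma coord_vector_self [simp]: "c \<in> A \<Longrightarrow> p \<in> dom_of c \<Longrightarrow> coord_vector A c p i c = axis i 1"
  by (simp add: coord_vector_def)

lemma linear_form_expand:
  assumes f: "linear_form_on (tangent_space A p) f" and c: "c \<in> A" "p \<in> dom_of c" and v: "v \<in> tangent_space A p"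
  shows "f v = (\<Sum>i\<in>UNIV. v c $ i * f (coord_vector A c p i))"
proof -
  let ?e = "\<lambda>i. coord_vector A c p i"
  note e = coord_vector_tangent[OF c]
  have lin: "f (\<lambda>c. r *\<^sub>R u c + s *\<^sub>R w c) = r * f u + s * f w"
    if "u \<in> tangent_space A p" "w \<in> tangent_space A p" for u w r s
    using f that unfolding linear_form_on_def by blast
  let ?u = "\<lambda>d. v c $ 1 *\<^sub>R ?e 1 d + v c $ 2 *\<^sub>R ?e 2 d"
  have u: "?u \<in> tangent_space A p" by (intro tangent_lincomb e)
  have "v = (\<lambda>d. 1 *\<^sub>R ?u d + v c $ 3 *\<^sub>R ?e 3 d)"
  proof (rule tangent_eqI[OF v _ c])
    show "(\<lambda>d. 1 *\<^sub>R ?u d + v c $ 3 *\<^sub>R ?e 3 d) \<in> tangent_space A p" by (intro tangent_lincomb u e)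
    show "v c = 1 *\<^sub>R ?u c + v c $ 3 *\<^sub>R ?e 3 c"
      using c by (simp add: vec_eq_iff forall_3 axis_def)
  qed
  then have "f v = 1 * f ?u + v c $ 3 * f (?e 3)"
    using lin[OF u e, of 1 "v c $ 3" 3] by simp
  then show ?thesis by (simp add: lin[OF e e] sum_3)
qed

definition form_in :: "'a chart \<Rightarrow> 'a form1 \<Rightarrow> real^3 \<Rightarrow> real^3" where
  "form_in c \<alpha> x = (\<chi> i. form_comp A c \<alpha> i x)"

definition field_in :: "'a chart \<Rightarrow> 'a vector_field \<Rightarrow> real^3 \<Rightarrow> real^3" where
  "field_in c X x = X (coord_inv c x) c"

abbreviation metric_in :: "'a chart \<Rightarrow> 'a metric \<Rightarrow> real^3 \<Rightarrow> real^3^3" where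
  "metric_in c g \<equiv> metric_matrix A c g"

lemma form_eval:
  assumes "linear_form_on (tangent_space A p) (\<alpha> p)" "c \<in> A" "p \<in> dom_of c" "v \<in> tangent_space A p"
  shows "\<alpha> p v = form_in c \<alpha> (coord c p) \<bullet> v c"
  using linear_form_expand[OF assms] assms
  by (simp add: form_in_def form_comp_def inner_vec_def mult.commute)

lemma metric_eval:
  assumes lin: "\<And>u. u \<in> tangent_space A p \<Longrightarrow> linear_form_on (tangent_space A p) (g p u)"
    and sym: "\<And>u v. u \<in> tangent_space A p \<Longrightarrow> v \<in> tangent_space A p \<Longrightarrow> g p u v = g p v u"
    and c: "c \<in> A" "p \<in> dom_of c" and uv: "u \<in> tangent_space A p" "v \<in> tangent_space A p"
  shows "g p u v = u c \<bullet> (metric_in c g (coord c p) *v v c)"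
proof -
  let ?e = "\<lambda>i. coord_vector A c p i"
  have "g p u v = (\<Sum>j\<in>UNIV. v c $ j * g p (?e j) u)"
    using linear_form_expand[OF lin c uv(2)] uv sym coord_vector_tangent[OF c] by simp
  also have "\<dots> = (\<Sum>j\<in>UNIV. v c $ j * (\<Sum>i\<in>UNIV. u c $ i * g p (?e i) (?e j)))"
    using linear_form_expand[OF lin c uv(1)] sym coord_vector_tangent[OF c] by simp
  finally show ?thesis
    using c by (simp add: metric_matrix_def inner_vec_def matrix_vec_nth sum_3 algebra_simps)
qed

lemma form_in_transition:
  assumes lin: "linear_form_on (tangent_space A p) (\<alpha> p)"
    and cd: "c \<in> A" "d \<in> A" "p \<in> dom_of c" "p \<in> dom_of d"
  shows "form_in c \<alpha> (coord c p) = transpose (jac c d p) *v form_in d \<alpha> (coord d p)"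
proof -
  have "form_in c \<alpha> (coord c p) $ i = form_in d \<alpha> (coord d p) \<bullet> (jac c d p *v axis i 1)" for i
    using form_eval[of p \<alpha> d "coord_vector A c p i"] lin coord_vector_tangent[OF cd(1,3)] cd
    by (simp add: form_in_def form_comp_def coord_vector_def tangent_of_comp)
  then show ?thesis
    by (simp add: vec_eq_iff matrix_vec_nth matrix_vector_mult_basis column_def transpose_def
        inner_vec_def mult.commute)
qed

lemma exterior_transition:
  assumes \<alpha>: "smooth_1_form A \<alpha>" and cd: "c \<in> A" "d \<in> A" "p \<in> dom_of c" "p \<in> dom_of d"
  shows "exterior (form_in c \<alpha>) (coord c p)
    = transpose (jac c d p) ** exterior (form_in d \<alpha>) (coord d p) ** jac c d p"
proof -
  have lin: "linear_form_on (tangent_space A q) (\<alpha> q)" if "q \<in> dom_of c" for q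
    using \<alpha> dom_points[OF cd(1) that] by (simp add: smooth_1_form_def)
  have "(\<lambda>y. form_in d \<alpha> y $ i) differentiable (at (coord d p))" for i
    using \<alpha> cd chart_open(2)[OF cd(2)] unfolding form_in_def smooth_1_form_def
    by (auto intro!: smooth_on_differentiable)
  then have "exterior (form_in c \<alpha>) (coord c p) = transpose (grad (transition c d) (coord c p))
      ** exterior (form_in d \<alpha>) (transition c d (coord c p)) ** grad (transition c d) (coord c p)"
    using cd lin
    by (intro exterior_pullback[OF overlap_open _ transition_smooth, of c d])
      (auto simp: overlap_def form_in_transition[of _ _ c d] jac_grad)
  then show ?thesis using cd by (simp add: jac_grad)
qed

text \<open>The exterior derivative is defined through the chart selected at each point, so a formula valid in a
  fixed chart near \<open>p\<close>, which can be differentiated, needs the transition rule.\<close>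

lemma ext_deriv_eval:
  assumes \<alpha>: "smooth_1_form A \<alpha>" and c: "c \<in> A" "p \<in> dom_of c"
    and uv: "u \<in> tangent_space A p" "v \<in> tangent_space A p"
  shows "ext_deriv A \<alpha> p u v = u c \<bullet> (exterior (form_in c \<alpha>) (coord c p) *v v c)"
proof -
  define d where "d = chart_at A p"
  have d: "d \<in> A" "p \<in> dom_of d" using chart_at dom_points c by (auto simp: d_def)
  have "ext_deriv A \<alpha> p u v = u d \<bullet> (exterior (form_in d \<alpha>) (coord d p) *v v d)"
    by (simp add: ext_deriv_def Let_def form_in_def exterior_nth inner_vec_def matrix_vec_nth
        sum_distrib_left mult_ac flip: d_def)
  also have "u d = jac c d p *v u c" using uv c d tangent_transition by blast
  also have "v d = jac c d p *v v c" using uv c d tangent_transition by blast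
  also have "(jac c d p *v u c) \<bullet> (exterior (form_in d \<alpha>) (coord d p) *v (jac c d p *v v c))
    = u c \<bullet> ((transpose (jac c d p) ** exterior (form_in d \<alpha>) (coord d p) ** jac c d p) *v v c)"
    by (rule inner_pullback)
  finally show ?thesis using exterior_transition[OF \<alpha> c(1) d(1) c(2) d(2)] by simp
qed

end

lemma christoffel_eq: "christoffel A c g k i j = christoffel_of (metric_matrix A c g) k i j"
  by (rule ext) (simp add: christoffel_def christoffel_of_def)

lemma riemann_coeff_eq: "riemann_coeff A c g l i j k x = riemann_of (metric_matrix A c g) l i j k x"
  by (simp add: riemann_coeff_def riemann_of_def christoffel_eq)

lemma axis_inner_mult: "axis i 1 \<bullet> ((N::real^3^3) *v axis j 1) = N $ i $ j"
  by (simp add: inner_axis' matrix_vector_mult_basis column_def)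

lemma matrix_eqI_bilinear:
  fixes N K :: "real^3^3"
  assumes "\<And>i j. axis i 1 \<bullet> (N *v axis j 1) = axis i 1 \<bullet> (K *v axis j 1)"
  shows "N = K"
  using assms by (simp add: axis_inner_mult vec_eq_iff)

text \<open>If the columns of \<open>E\<close> form the frame, then \<open>transpose E ** G ** E = mat 1\<close>, so \<open>transpose E ** G\<close> is the
  inverse of \<open>E\<close> and the sum is the trace of a conjugate of \<open>T\<close>.\<close>

lemma trace_orthonormal_frame:
  fixes G T :: "real^3^3" and e :: "3 \<Rightarrow> real^3"
  assumes sym: "transpose G = G"
    and orth: "\<And>i j. e i \<bullet> (G *v e j) = (if i = j then 1 else 0)"
  shows "(\<Sum>i\<in>UNIV. (T *v e i) \<bullet> (G *v e i)) = trace T"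
proof -
  define E :: "real^3^3" where "E = (\<chi> r i. e i $ r)"
  have E: "E *v axis i 1 = e i" for i
    by (simp add: matrix_vector_mult_basis column_def E_def)
  have "(transpose E ** G ** E) = mat 1"
  proof (rule matrix_eqI_bilinear)
    fix i j :: 3
    show "axis i 1 \<bullet> ((transpose E ** G ** E) *v axis j 1) = axis i 1 \<bullet> ((mat 1 :: real^3^3) *v axis j 1)"
      using orth[of i j] inner_pullback[of E "axis i 1" G "axis j 1"] by (simp add: E inner_axis_axis inner_real_def split: if_splits)
  qed
  then have inv: "E ** (transpose E ** G) = mat 1"
    using matrix_left_right_inverse by blast
  have "(T *v e i) \<bullet> (G *v e i) = (transpose E ** (G ** T) ** E) $ i $ i" for i
  proof -
    have "(T *v e i) \<bullet> (G *v e i) = e i \<bullet> ((G ** T) *v e i)"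
      using sym by (metis dot_lmul_matrix inner_commute matrix_vector_mul_assoc vector_transpose_matrix)
    then show ?thesis
      using inner_pullback[of E "axis i 1" "G ** T" "axis i 1"] by (simp add: E axis_inner_mult)
  qed
  then have "(\<Sum>i\<in>UNIV. (T *v e i) \<bullet> (G *v e i)) = trace (transpose E ** G ** T ** E)"
    by (simp add: trace_def matrix_mul_assoc)
  also have "\<dots> = trace (E ** (transpose E ** G) ** T)"
    by (subst trace_mul_sym) (simp add: matrix_mul_assoc)
  finally show ?thesis by (simp add: inv)
qed

section \<open>Compatible metrics\<close>

locale compatible = manifold M A
  for M :: "'a topology" and A :: "'a chart set" +
  fixes \<xi> :: "'a \<Rightarrow> 'a tangent set" and \<theta> :: real and g :: "'a metric" and \<alpha> :: "'a form1"
    and X :: "'a vector_field" and J :: "'a \<Rightarrow> 'a tangent \<Rightarrow> 'a tangent"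
  assumes compatible: "compatible_metric A \<xi> \<theta> g \<alpha> X J"
begin

lemma \<theta>_pos: "\<theta> > 0"
  and riemannian: "riemannian_metric A g"
  and contact: "contact_form A \<alpha>"
  and smooth_\<alpha>: "smooth_1_form A \<alpha>"
  and reeb: "reeb_field A \<alpha> X"
  and complex: "complex_structure_on A \<xi> \<alpha> X J"
  and \<xi>_eq: "p \<in> points A \<Longrightarrow> \<xi> p = {v \<in> tangent_space A p. \<alpha> p v = 0}"
  and g_eq: "p \<in> points A \<Longrightarrow> u \<in> tangent_space A p \<Longrightarrow> v \<in> tangent_space A p \<Longrightarrow>
    g p u v = 1 / \<theta> * ext_deriv A \<alpha> p u (extend_endo \<alpha> X J p v) + \<alpha> p u * \<alpha> p v"
  using compatible by (auto simp: compatible_metric_def contact_form_for_def contact_form_def)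

lemma lin_\<alpha>: "p \<in> points A \<Longrightarrow> linear_form_on (tangent_space A p) (\<alpha> p)"
  using smooth_\<alpha> by (simp add: smooth_1_form_def)

lemma lin_g: "p \<in> points A \<Longrightarrow> u \<in> tangent_space A p \<Longrightarrow> linear_form_on (tangent_space A p) (g p u)"
  and sym_g: "p \<in> points A \<Longrightarrow> u \<in> tangent_space A p \<Longrightarrow> v \<in> tangent_space A p \<Longrightarrow> g p u v = g p v u"
  and pos_g: "p \<in> points A \<Longrightarrow> u \<in> tangent_space A p \<Longrightarrow> u \<noteq> (\<lambda>c. 0) \<Longrightarrow> g p u u > 0"
  using riemannian unfolding riemannian_metric_def by blast+

lemma X_tangent: "p \<in> points A \<Longrightarrow> X p \<in> tangent_space A p"
  and \<alpha>_X: "p \<in> points A \<Longrightarrow> \<alpha> p (X p) = 1"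
  and d\<alpha>_X: "p \<in> points A \<Longrightarrow> v \<in> tangent_space A p \<Longrightarrow> ext_deriv A \<alpha> p (X p) v = 0"
  using reeb unfolding reeb_field_def smooth_vector_field_def by blast+

lemma J_\<xi>: "p \<in> points A \<Longrightarrow> u \<in> \<xi> p \<Longrightarrow> J p u \<in> \<xi> p"
  and J_J: "p \<in> points A \<Longrightarrow> u \<in> \<xi> p \<Longrightarrow> J p (J p u) = (\<lambda>c. - u c)"
  and J_lin: "p \<in> points A \<Longrightarrow> u \<in> \<xi> p \<Longrightarrow> v \<in> \<xi> p \<Longrightarrow>
           J p (\<lambda>c. r *\<^sub>R u c + s *\<^sub>R v c) = (\<lambda>c. r *\<^sub>R J p u c + s *\<^sub>R J p v c)"
  using complex unfolding complex_structure_on_def by blast+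

lemma \<xi>_tangent: "p \<in> points A \<Longrightarrow> v \<in> \<xi> p \<Longrightarrow> v \<in> tangent_space A p"
  by (simp add: \<xi>_eq)

lemma \<alpha>_\<xi>: "p \<in> points A \<Longrightarrow> v \<in> \<xi> p \<Longrightarrow> \<alpha> p v = 0"
  by (simp add: \<xi>_eq)

lemma \<alpha>_lincomb: "p \<in> points A \<Longrightarrow> u \<in> tangent_space A p \<Longrightarrow> v \<in> tangent_space A p \<Longrightarrow>
    \<alpha> p (\<lambda>c. r *\<^sub>R u c + s *\<^sub>R v c) = r * \<alpha> p u + s * \<alpha> p v"
  using lin_\<alpha> unfolding linear_form_on_def by blast

lemma proj_\<xi>:
  assumes "p \<in> points A" "v \<in> tangent_space A p"
  shows "(\<lambda>c. v c - \<alpha> p v *\<^sub>R X p c) \<in> \<xi> p"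
  using tangent_lincomb[OF assms(2) X_tangent[OF assms(1)], of 1 "- \<alpha> p v"]
    \<alpha>_lincomb[OF assms X_tangent[OF assms(1)], of 1 "- \<alpha> p v"] assms
  by (simp add: \<xi>_eq \<alpha>_X)

abbreviation "\<phi> \<equiv> extend_endo \<alpha> X J"

lemma \<phi>_\<xi>: "p \<in> points A \<Longrightarrow> v \<in> \<xi> p \<Longrightarrow> \<phi> p v = J p v"
  by (simp add: extend_endo_def \<alpha>_\<xi>)

lemma \<phi>_in: "p \<in> points A \<Longrightarrow> v \<in> tangent_space A p \<Longrightarrow> \<phi> p v \<in> \<xi> p"
  by (simp add: extend_endo_def J_\<xi> proj_\<xi>)

lemma \<phi>_\<phi>: "p \<in> points A \<Longrightarrow> v \<in> tangent_space A p \<Longrightarrow> \<phi> p (\<phi> p v) = (\<lambda>c. \<alpha> p v *\<^sub>R X p c - v c)"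
  using \<phi>_\<xi>[OF _ \<phi>_in, of p v] J_J[OF _ proj_\<xi>, of p v] by (simp add: extend_endo_def)

lemma J_zero:
  assumes p: "p \<in> points A"
  shows "J p (\<lambda>c. 0) = (\<lambda>c. 0)"
proof -
  have "X p \<in> tangent_space A p" using X_tangent p .
  from J_lin[OF p proj_\<xi>[OF p this] proj_\<xi>[OF p this], of 0 0] show ?thesis by simp
qed

lemma \<phi>_X: "p \<in> points A \<Longrightarrow> \<phi> p (X p) = (\<lambda>c. 0)"
  by (simp add: extend_endo_def \<alpha>_X J_zero)

lemma \<phi>_lincomb:
  assumes p: "p \<in> points A" and uv: "u \<in> tangent_space A p" "v \<in> tangent_space A p"
  shows "\<phi> p (\<lambda>c. r *\<^sub>R u c + s *\<^sub>R v c) = (\<lambda>c. r *\<^sub>R \<phi> p u c + s *\<^sub>R \<phi> p v c)"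
proof -
  have "(\<lambda>c. r *\<^sub>R u c + s *\<^sub>R v c - (r * \<alpha> p u + s * \<alpha> p v) *\<^sub>R X p c)
      = (\<lambda>c. r *\<^sub>R (u c - \<alpha> p u *\<^sub>R X p c) + s *\<^sub>R (v c - \<alpha> p v *\<^sub>R X p c))"
    by (simp add: algebra_simps)
  then show ?thesis
    using J_lin[OF p proj_\<xi>[OF p uv(1)] proj_\<xi>[OF p uv(2)], of r s]
    by (simp add: extend_endo_def \<alpha>_lincomb[OF p uv])
qed

definition endo_in :: "'a chart \<Rightarrow> real^3 \<Rightarrow> real^3^3" where
  "endo_in c x = (\<chi> i j. \<phi> (coord_inv c x) (coord_vector A c (coord_inv c x) j) c $ i)"

context
  fixes c p assumes c: "c \<in> A" "p \<in> dom_of c"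
begin

lemma p_point: "p \<in> points A"
  using dom_points c .

lemma \<alpha>_eval: "v \<in> tangent_space A p \<Longrightarrow> \<alpha> p v = form_in c \<alpha> (coord c p) \<bullet> v c"
  by (rule form_eval[of p \<alpha> c v]) (simp_all add: lin_\<alpha> p_point c)

lemma d\<alpha>_eval: "u \<in> tangent_space A p \<Longrightarrow> v \<in> tangent_space A p \<Longrightarrow>
    ext_deriv A \<alpha> p u v = u c \<bullet> (exterior (form_in c \<alpha>) (coord c p) *v v c)"
  by (rule ext_deriv_eval[OF smooth_\<alpha> c])

lemma g_eval: "u \<in> tangent_space A p \<Longrightarrow> v \<in> tangent_space A p \<Longrightarrow>
    g p u v = u c \<bullet> (metric_in c g (coord c p) *v v c)"
  by (rule metric_eval) (simp_all add: lin_g sym_g p_point c)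

lemma field_in_coord: "field_in c X (coord c p) = X p c"
  by (simp add: field_in_def c)

text \<open>For a fixed chart and index, the component of \<open>\<phi> p v\<close> is a linear form in \<open>v\<close>.\<close>

lemma \<phi>_eval:
  assumes v: "v \<in> tangent_space A p"
  shows "\<phi> p v c = endo_in c (coord c p) *v v c"
proof -
  have "\<phi> p v c $ i = (\<Sum>j\<in>UNIV. v c $ j * \<phi> p (coord_vector A c p j) c $ i)" for i
    using v c p_point by (intro linear_form_expand[of p "\<lambda>v. \<phi> p v c $ i"])
      (auto simp: linear_form_on_def \<phi>_lincomb)
  then show ?thesis
    using c by (simp add: vec_eq_iff matrix_vec_nth endo_in_def mult.commute)
qed

lemma coord_relations:
  defines "G \<equiv> metric_in c g (coord c p)" and "a \<equiv> form_in c \<alpha> (coord c p)"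
    and "x \<equiv> field_in c X (coord c p)" and "\<Phi> \<equiv> endo_in c (coord c p)"
    and "F \<equiv> exterior (form_in c \<alpha>) (coord c p)"
  shows "invertible G" "transpose G = G" "G *v x = a" "a \<bullet> x = 1" "F *v x = 0"
    "\<Phi> ** \<Phi> = outer x a - mat 1" "a v* \<Phi> = 0" "G = (1 / \<theta>) *\<^sub>R (F ** \<Phi>) + outer a a"
proof -
  let ?e = "coord_vector A c p"
  note p = p_point
  note e = coord_vector_tangent[OF c]
  have ec [simp]: "?e i c = axis i 1" for i using c by simp
  note X = X_tangent[OF p]
  have Xc: "X p c = x" by (simp add: x_def field_in_coord)
  have ge: "g p u v = u c \<bullet> (G *v v c)" if "u \<in> tangent_space A p" "v \<in> tangent_space A p" for u v
    using g_eval that by (simp add: G_def)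
  have \<alpha>e: "\<alpha> p v = a \<bullet> v c" if "v \<in> tangent_space A p" for v
    using \<alpha>_eval that by (simp add: a_def)
  have de: "ext_deriv A \<alpha> p u v = u c \<bullet> (F *v v c)" if "u \<in> tangent_space A p" "v \<in> tangent_space A p" for u v
    using d\<alpha>_eval that by (simp add: F_def)
  have \<phi>e: "\<phi> p v c = \<Phi> *v v c" if "v \<in> tangent_space A p" for v
    using \<phi>_eval that by (simp add: \<Phi>_def)
  have \<phi>t: "\<phi> p v \<in> tangent_space A p" if "v \<in> tangent_space A p" for v
    using \<phi>_in \<xi>_tangent that p by blast
  show "transpose G = G"
    using ge[OF e e] sym_g[OF p e e] by (simp add: vec_eq_iff transpose_def axis_inner_mult)
  show "invertible G"
  proof -
    have "w = 0" if "G *v w = 0" for w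
    proof (rule ccontr)
      assume "w \<noteq> 0"
      then have "tangent_of A c p w \<noteq> (\<lambda>d. 0)"
        using tangent_of_self[OF c, of w] by metis
      from pos_g[OF p tangent_of_tangent[OF c] this] show False
        using that c by (simp add: ge tangent_of_tangent)
    qed
    then show ?thesis
      by (simp add: invertible_left_inverse matrix_left_invertible_ker)
  qed
  show "a \<bullet> x = 1" using \<alpha>e[OF X] \<alpha>_X[OF p] by (simp add: Xc)
  have comp: "axis i 1 \<bullet> w = w $ i" for i and w :: "real^3" by (simp add: inner_axis')
  show "G *v x = a"
  proof -
    have "axis i 1 \<bullet> (G *v x) = a \<bullet> axis i 1" for i
      using ge[OF e X, of i] g_eq[OF p e X, of i] de[OF e tangent_zero, of i] \<alpha>e[OF e, of i]
      by (simp add: Xc \<phi>_X p \<alpha>_X)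
    then show ?thesis by (simp add: vec_eq_iff comp inner_axis)
  qed
  show "F *v x = 0"
  proof -
    have "(F *v x) $ i = - (x \<bullet> (F *v axis i 1))" for i
      by (simp add: F_def exterior_nth matrix_vec_nth matrix_vector_mult_basis column_def inner_vec_def
          sum_3 algebra_simps)
    moreover have "x \<bullet> (F *v axis i 1) = 0" for i
      using de[OF X e] d\<alpha>_X[OF p e] by (simp add: Xc)
    ultimately show ?thesis
      by (simp add: vec_eq_iff)
  qed
  show "\<Phi> ** \<Phi> = outer x a - mat 1"
  proof (rule matrix_eqI_bilinear)
    fix i j
    have "\<Phi> *v (\<Phi> *v axis j 1) = (a \<bullet> axis j 1) *\<^sub>R x - axis j 1"
      using \<phi>e[OF \<phi>t[OF e], of j] \<phi>_\<phi>[OF p e, of j] by (simp add: \<phi>e e \<alpha>e Xc)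
    then show "axis i 1 \<bullet> ((\<Phi> ** \<Phi>) *v axis j 1) = axis i 1 \<bullet> ((outer x a - mat 1) *v axis j 1)"
      by (simp add: matrix_vector_mul_assoc[symmetric] comp matrix_vector_mult_diff_rdistrib)
         (simp add: matrix_vector_mult_basis column_def inner_axis)
  qed
  show "a v* \<Phi> = 0"
  proof -
    have "(a v* \<Phi>) \<bullet> axis j 1 = 0" for j
      using \<alpha>e[OF \<phi>t[OF e], of j] \<alpha>_\<xi>[OF p \<phi>_in[OF p e], of j]
      by (simp add: \<phi>e e dot_lmul_matrix)
    then show ?thesis by (simp add: vec_eq_iff inner_axis)
  qed
  show "G = (1 / \<theta>) *\<^sub>R (F ** \<Phi>) + outer a a"
  proof (rule matrix_eqI_bilinear)
    fix i j
    show "axis i 1 \<bullet> (G *v axis j 1) = axis i 1 \<bullet> (((1 / \<theta>) *\<^sub>R (F ** \<Phi>) + outer a a) *v axis j 1)"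
      using ge[OF e e, of i j] g_eq[OF p e e, of i j] de[OF e \<phi>t[OF e], of i j] \<alpha>e[OF e, of i] \<alpha>e[OF e, of j]
      by (simp add: \<phi>e e matrix_vector_mult_add_rdistrib inner_add_right matrix_vector_mul_assoc[symmetric]
          scaleR_matrix_vector_assoc[symmetric] axis_inner_mult[of _ "outer a a"] inner_axis)
  qed
qed

end

lemma in_coords:
  assumes c: "c \<in> A"
  shows "compatible_coords (img_of c) \<theta> (metric_in c g) (form_in c \<alpha>) (field_in c X) (endo_in c)"
proof (unfold_locales)
  show "open (img_of c)" using chart_open(2) c .
  show "\<theta> > 0" by (rule \<theta>_pos)
  show "smooth_on (img_of c) (\<lambda>y. metric_in c g y $ i $ j)" for i j
    using riemannian c by (simp add: riemannian_metric_def)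
  show "smooth_on (img_of c) (\<lambda>y. form_in c \<alpha> y $ i)" for i
    using smooth_\<alpha> c by (simp add: smooth_1_form_def form_in_def)
  show "smooth_on (img_of c) (\<lambda>y. field_in c X y $ i)" for i
    using reeb c by (simp add: reeb_field_def smooth_vector_field_def field_in_def)
  show "smooth_on (img_of c) (\<lambda>y. endo_in c y $ i $ j)" for i j
    using complex c by (simp add: complex_structure_on_def endo_in_def)
qed (use c coord_relations[OF c] in auto)

section \<open>The Ricci curvature of the Reeb field\<close>

definition tors :: "'a chart \<Rightarrow> 'a \<Rightarrow> real" where
  "tors c p = torsion (metric_in c g) (field_in c X) (coord c p)"

lemma tors_chart:
  assumes cd: "c \<in> A" "d \<in> A" "p \<in> dom_of c" "p \<in> dom_of d"
  shows "tors c p = tors d p"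
proof -
  interpret c: compatible_coords "img_of c" \<theta> "metric_in c g" "form_in c \<alpha>" "field_in c X" "endo_in c"
    using in_coords cd by blast
  interpret d: compatible_coords "img_of d" \<theta> "metric_in d g" "form_in d \<alpha>" "field_in d X" "endo_in d"
    using in_coords cd by blast
  have Gq: "metric_in c g (coord c q) = transpose (jac c d q) ** metric_in d g (coord d q) ** jac c d q"
    if q: "q \<in> dom_of c" "q \<in> dom_of d" for q
  proof (rule matrix_eqI_bilinear)
    fix i j
    note e = coord_vector_tangent[OF cd(1) q(1)]
    show "axis i 1 \<bullet> (metric_in c g (coord c q) *v axis j 1)
      = axis i 1 \<bullet> ((transpose (jac c d q) ** metric_in d g (coord d q) ** jac c d q) *v axis j 1)"
      using g_eval[OF cd(1) q(1) e e, of i j] g_eval[OF cd(2) q(2) e e, of i j] cd q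
      by (simp add: coord_vector_def tangent_of_comp inner_pullback)
  qed
  have Xq: "field_in d X (coord d q) = jac c d q *v field_in c X (coord c q)"
    if q: "q \<in> dom_of c" "q \<in> dom_of d" for q
    using tangent_transition[OF X_tangent[OF dom_points[OF cd(1) q(1)]] cd(1,2) q] cd q
    by (simp add: field_in_coord)
  have P: "jac c d p = grad (transition c d) (coord c p)"
    using cd by (rule jac_grad)
  have x: "coord c p \<in> img_of c" "coord d p \<in> img_of d" using cd by auto
  have "lie (field_in c X) (metric_in c g) (coord c p)
      = transpose (grad (transition c d) (coord c p))
        ** lie (field_in d X) (metric_in d g) (transition c d (coord c p)) ** grad (transition c d) (coord c p)"
    using cd x
    by (intro lie_pullback[OF overlap_open[OF cd(1,2)] _ transition_smooth[OF cd(1,2)]] c.diff_X)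
      (auto simp: overlap_def Xq Gq jac_grad d.diff_X d.diff_G)
  then show ?thesis
    unfolding tors_def torsion_def using cd x
    by (intro torsion_pullback[OF jac_invertible[OF cd] d.invertible_G Gq]) (simp_all add: P)
qed

text \<open>The unit vectors \<open>e\<close>, \<open>J e\<close> and \<open>X\<close> form an orthonormal frame. The sum of the two sectional curvatures is
  the trace over this frame of \<open>u \<mapsto> R(u,X)X\<close>, which vanishes on \<open>X\<close>.\<close>

lemma ricci_eq:
  assumes p: "p \<in> points A" and e: "e \<in> \<xi> p" "g p e e = 1"
  shows "ricci_reeb A g X J p e = \<theta>\<^sup>2 / 2 - tors (chart_at A p) p / 4"
proof -
  define c where "c = chart_at A p"
  have c: "c \<in> A" "p \<in> dom_of c" using chart_at p by (auto simp: c_def)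
  interpret c: compatible_coords "img_of c" \<theta> "metric_in c g" "form_in c \<alpha>" "field_in c X" "endo_in c"
    using in_coords c by blast
  let ?G = "metric_in c g (coord c p)"
  let ?R = "\<lambda>l i j k. riemann_of (metric_in c g) l i j k (coord c p)"
  define T :: "real^3^3" where "T = (\<chi> l i. \<Sum>j\<in>UNIV. \<Sum>k\<in>UNIV. ?R l i j k * X p c $ j * X p c $ k)"
  have x: "coord c p \<in> img_of c" using c by auto
  note X = X_tangent[OF p] and et = \<xi>_tangent[OF p e(1)]
  have Je: "J p e \<in> \<xi> p" using J_\<xi> p e by blast
  note Jt = \<xi>_tangent[OF p Je]
  have skew: "ext_deriv A \<alpha> p u v = - ext_deriv A \<alpha> p v u"
    if "u \<in> tangent_space A p" "v \<in> tangent_space A p" for u v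
    using that by (simp add: d\<alpha>_eval[OF c] inner_vec_def matrix_vec_nth exterior_nth sum_3 algebra_simps)
  have neg: "(\<lambda>c. - e c) \<in> tangent_space A p" "ext_deriv A \<alpha> p u (\<lambda>c. - e c) = - ext_deriv A \<alpha> p u e"
    if "u \<in> tangent_space A p" for u
  proof -
    show "(\<lambda>c. - e c) \<in> tangent_space A p" using tangent_lincomb[OF et et, of "-1" 0] by simp
    then show "ext_deriv A \<alpha> p u (\<lambda>c. - e c) = - ext_deriv A \<alpha> p u e"
      using that et by (simp add: d\<alpha>_eval[OF c] inner_vec_def matrix_vec_nth sum_3 algebra_simps)
  qed
  have gX: "g p u (X p) = \<alpha> p u" if "u \<in> tangent_space A p" for u
    using that X c.G_X[OF x] c p \<alpha>_eval[OF c that] g_eval[OF c that X]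
    by (simp add: field_in_coord[OF c] inner_commute)
  have ee: "ext_deriv A \<alpha> p e e = 0" using skew[OF et et] by simp
  have geJ: "g p e (J p e) = 0"
    using g_eq[OF p et Jt] neg(2)[OF et] ee by (simp add: \<phi>_\<xi> p Je J_J e \<alpha>_\<xi>)
  have gJJ: "g p (J p e) (J p e) = 1"
    using g_eq[OF p Jt Jt] g_eq[OF p et et] neg(2)[OF Jt] skew[OF Jt et] e
    by (simp add: \<phi>_\<xi> p Je J_J \<alpha>_\<xi>)
  have gXX: "g p (X p) (X p) = 1" using gX[OF X] \<alpha>_X p by simp
  have geX: "g p e (X p) = 0" "g p (J p e) (X p) = 0"
    using gX et Jt \<alpha>_\<xi>[OF p] e Je by auto
  have Rt: "curvature A g p u (X p) (X p) = tangent_of A c p (T *v u c)" for u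
    by (simp add: curvature_def Let_def riemann_coeff_eq T_def matrix_vector_mult_def sum_3 algebra_simps
        flip: c_def)
  have gR: "g p (curvature A g p u (X p) (X p)) u = (T *v u c) \<bullet> (?G *v u c)"
    if "u \<in> tangent_space A p" for u
    using g_eval[OF c tangent_of_tangent[OF c] that] c by (simp add: Rt)
  have "ricci_reeb A g X J p e = (T *v e c) \<bullet> (?G *v e c) + (T *v J p e c) \<bullet> (?G *v J p e c)"
    by (simp add: ricci_reeb_def sectional_curvature_def e gXX gJJ geX gR et Jt)
  moreover have "(T *v X p c) \<bullet> (?G *v X p c) = 0"
  proof -
    have skewR: "?R l i j k = - ?R l j i k" for l i j k
      by (simp add: riemann_of_def sum_subtractf)
    have "(\<Sum>i\<in>UNIV. \<Sum>j\<in>UNIV. \<Sum>k\<in>UNIV. ?R l i j k * X p c $ j * X p c $ k * X p c $ i) = 0" (is "?S = 0") for l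
    proof -
      have "?S = (\<Sum>i\<in>UNIV. \<Sum>j\<in>UNIV. \<Sum>k\<in>UNIV. - (?R l j i k * X p c $ i * X p c $ k * X p c $ j))"
        by (intro sum.cong refl, subst skewR) simp
      also have "\<dots> = - (\<Sum>i\<in>UNIV. \<Sum>j\<in>UNIV. \<Sum>k\<in>UNIV. ?R l j i k * X p c $ i * X p c $ k * X p c $ j)"
        by (simp only: sum_negf)
      also have "(\<Sum>i\<in>UNIV. \<Sum>j\<in>UNIV. \<Sum>k\<in>UNIV. ?R l j i k * X p c $ i * X p c $ k * X p c $ j) = ?S"
        by (rule sum.swap)
      finally show ?thesis by simp
    qed
    then have "T *v X p c = 0"
      by (simp add: vec_eq_iff T_def matrix_vec_nth sum_distrib_right)
    then show ?thesis by simp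
  qed
  moreover have "(\<Sum>i\<in>UNIV. (T *v (vector [e c, J p e c, X p c] :: (real^3)^3) $ i)
      \<bullet> (?G *v (vector [e c, J p e c, X p c] :: (real^3)^3) $ i)) = trace T"
  proof (rule trace_orthonormal_frame)
    show "transpose ?G = ?G" using c.sym_G x by blast
    have "u c \<bullet> (?G *v v c) = g p u v" if "u \<in> tangent_space A p" "v \<in> tangent_space A p" for u v
      using g_eval[OF c that] by simp
    then have "\<forall>i j. (vector [e c, J p e c, X p c] :: (real^3)^3) $ i \<bullet> (?G *v (vector [e c, J p e c, X p c] :: (real^3)^3) $ j)
      = (if i = j then 1 else 0)"
      using e geJ gJJ gXX geX sym_g[OF p] et Jt X by (simp add: forall_3)
    then show "(vector [e c, J p e c, X p c] :: (real^3)^3) $ i \<bullet> (?G *v (vector [e c, J p e c, X p c] :: (real^3)^3) $ j)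
      = (if i = j then 1 else 0)" for i j by blast
  qed
  moreover have "trace T = \<theta>\<^sup>2 / 2 - tors c p / 4"
    using c.ricci_X[OF x] by (simp add: trace_def T_def tors_def field_in_coord[OF c])
  ultimately show ?thesis by (simp add: sum_3 flip: c_def)
qed

text \<open>A bound on the Ricci curvature is stated for unit vectors of the contact plane; it has content at every
  point because such vectors exist.\<close>

lemma unit_vector_exists:
  assumes p: "p \<in> points A"
  shows "\<exists>e\<in>\<xi> p. g p e e = 1"
proof -
  define c where "c = chart_at A p"
  have c: "c \<in> A" "p \<in> dom_of c" using chart_at p by (auto simp: c_def)
  obtain w :: "real^3" where w: "w \<noteq> 0" "form_in c \<alpha> (coord c p) \<bullet> w = 0"
    using orthogonal_to_vector_exists[of "form_in c \<alpha> (coord c p)"] by (auto simp: orthogonal_def)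
  let ?v = "tangent_of A c p w"
  have v: "?v \<in> tangent_space A p" using tangent_of_tangent c .
  have "?v \<noteq> (\<lambda>d. 0)" using tangent_of_self[OF c, of w] w by metis
  then have pos: "g p ?v ?v > 0" using pos_g p v by blast
  define r where "r = 1 / sqrt (g p ?v ?v)"
  define e where "e = (\<lambda>d. r *\<^sub>R ?v d + 0 *\<^sub>R ?v d)"
  have et: "e \<in> tangent_space A p" unfolding e_def by (rule tangent_lincomb[OF v v])
  have ec: "e c = r *\<^sub>R w" using c by (simp add: e_def)
  have "\<alpha> p e = 0" using \<alpha>_eval[OF c et] w by (simp add: ec)
  then have "e \<in> \<xi> p" using et p by (simp add: \<xi>_eq)
  moreover have "g p e e = r\<^sup>2 * g p ?v ?v"
    using g_eval[OF c et et] g_eval[OF c v v] c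
    by (simp add: ec matrix_vector_mult_scaleR power2_eq_square)
  then have "g p e e = 1" using pos by (simp add: r_def power_divide)
  ultimately show ?thesis by blast
qed

lemma ricci_less_iff:
  "ricci_reeb_less A \<xi> g X J b \<longleftrightarrow> (\<forall>p\<in>points A. \<theta>\<^sup>2 / 2 - tors (chart_at A p) p / 4 < b)"
  unfolding ricci_reeb_less_def
proof (intro ball_cong refl iffI ballI impI)
  fix p assume p: "p \<in> points A"
  obtain e where "e \<in> \<xi> p" "g p e e = 1" using unit_vector_exists[OF p] by blast
  moreover assume "\<forall>e\<in>\<xi> p. g p e e = 1 \<longrightarrow> ricci_reeb A g X J p e < b"
  ultimately show "\<theta>\<^sup>2 / 2 - tors (chart_at A p) p / 4 < b" using ricci_eq[OF p] by fastforce
next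
  fix p e
  assume "p \<in> points A" "e \<in> \<xi> p" "g p e e = 1" "\<theta>\<^sup>2 / 2 - tors (chart_at A p) p / 4 < b"
  then show "ricci_reeb A g X J p e < b" using ricci_eq[of p e] by linarith
qed

end

section \<open>Rescaling the contact form by a constant\<close>

context compatible_coords
begin

lemma lie_rescale:
  assumes y: "y \<in> U" and k: "k > 0"
  shows "lie (\<lambda>y. (1 / k) *\<^sub>R X y) (\<lambda>y. k *\<^sub>R G y + (k\<^sup>2 - k) *\<^sub>R outer (a y) (a y)) y = lie X G y"
proof -
  have rX: "along (\<lambda>y. (1 / k) *\<^sub>R X y) H y = (1 / k) *\<^sub>R along X H y" for H
    by (simp add: vec_eq_iff along_def sum_divide_distrib)
  have gX: "grad (\<lambda>y. (1 / k) *\<^sub>R X y) y = (1 / k) *\<^sub>R grad X y"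
    using partial_cmult[OF diff_X[OF y], of _ "1 / k"] by (simp add: vec_eq_iff grad_nth)
  have da: "(\<lambda>y. outer (a y) (a y) $ i $ j) differentiable (at y)" for i j
    by (simp add: differentiable_mult diff_a y)
  have D: "along X (\<lambda>y. k *\<^sub>R G y + (k\<^sup>2 - k) *\<^sub>R outer (a y) (a y)) y
      = k *\<^sub>R along X G y + (k\<^sup>2 - k) *\<^sub>R (outer (along_vec X a y) (a y) + outer (a y) (along_vec X a y))"
    using da diff_G[OF y] diff_a[OF y]
    by (subst along_add) (auto simp: along_scaleR along_outer intro: differentiable_mult)
  have b: "along_vec X a y = - (transpose (grad X y) *v a y)"
    using lie_a[OF y] by (simp add: add_eq_0_iff2)
  have neg: "outer (- u) v = - outer u v" "outer v (- u) = - outer v u"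
    "outer (r *\<^sub>R u) v = r *\<^sub>R outer u v" for u v r
    by (simp_all add: vec_eq_iff)
  have tr: "transpose ((1 / k) *\<^sub>R N) = (1 / k) *\<^sub>R transpose N" for N :: "real^3^3"
    by (simp add: vec_eq_iff transpose_def)
  show ?thesis
    unfolding lie_def rX gX D b neg tr using k
    by (simp add: matrix_ring mult_outer outer_mult neg scaleR_add_right scaleR_diff_right
        flip: scaleR_matrix_vector_assoc)
qed

text \<open>On the annihilator of \<open>X\<close>, which contains the range of the Lie derivative, the inverse of the
  new metric is \<open>1 / k\<close> times the inverse of the old one.\<close>

lemma torsion_rescale:
  assumes y: "y \<in> U" and k: "k > 0"
    and inv: "invertible (k *\<^sub>R G y + (k\<^sup>2 - k) *\<^sub>R outer (a y) (a y))"
  shows "torsion (\<lambda>y. k *\<^sub>R G y + (k\<^sup>2 - k) *\<^sub>R outer (a y) (a y)) (\<lambda>y. (1 / k) *\<^sub>R X y) y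
    = torsion G X y / k\<^sup>2"
proof -
  let ?G = "k *\<^sub>R G y + (k\<^sup>2 - k) *\<^sub>R outer (a y) (a y)"
  let ?S = "matrix_inv (G y) ** lie X G y"
  have "a y v* ?S = 0"
  proof -
    have "X y v* G y = a y"
      using G_X[OF y] sym_G[OF y] by (metis vector_transpose_matrix)
    then have "a y v* ?S = X y v* (G y ** ?S)"
      by (metis vector_matrix_mul_assoc)
    also have "\<dots> = X y v* lie X G y"
      by (simp add: matrix_mul_assoc matrix_inv_inverse invertible_G y)
    also have "\<dots> = 0"
      using lie_G_X[OF y] sym_lie[OF y] by (metis vector_transpose_matrix)
    finally show ?thesis .
  qed
  then have "?G ** ((1 / k) *\<^sub>R ?S) = lie X G y"
    using k by (simp add: matrix_add_rdistrib matrix_scaleR_left matrix_scaleR_right outer_mult)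
      (simp add: matrix_mul_assoc matrix_inv_inverse invertible_G y)
  then have "matrix_inv ?G ** lie X G y = matrix_inv ?G ** ?G ** ((1 / k) *\<^sub>R ?S)"
    by (simp add: matrix_mul_assoc[symmetric])
  also have "\<dots> = (1 / k) *\<^sub>R ?S"
    by (simp add: matrix_inv_inverse[OF inv])
  finally have "matrix_inv ?G ** lie X G y = (1 / k) *\<^sub>R ?S" .
  then show ?thesis
    unfolding torsion_def lie_rescale[OF y k]
    by (simp add: matrix_scaleR_left matrix_scaleR_right trace_scaleR power2_eq_square)
qed

lemma continuous_torsion: "continuous_on U (torsion G X)"
proof -
  have "torsion G X differentiable (at y)" if y: "y \<in> U" for y
    unfolding torsion_def[abs_def] trace_def matrix_nth lie_def along_def transpose_def
      vector_add_component vec_lambda_beta grad_nth using y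
    by (intro differentiable_sum differentiable_mult differentiable_add ballI diff_inv diff_X diff_pX diff_G diff_pG) auto
  then show ?thesis
    by (simp add: continuous_at_imp_continuous_on differentiable_imp_continuous_within)
qed

end

context compatible
begin

lemma g_X:
  assumes p: "p \<in> points A" and u: "u \<in> tangent_space A p"
  shows "g p u (X p) = \<alpha> p u"
proof -
  have "ext_deriv A \<alpha> p u (\<lambda>c. 0) = 0" by (simp add: ext_deriv_def Let_def)
  then show ?thesis using g_eq[OF p u X_tangent[OF p]] by (simp add: \<phi>_X \<alpha>_X p)
qed

text \<open>The vector \<open>X\<close> has length one and \<open>\<alpha> p u\<close> is its inner product with \<open>u\<close>; the difference of the two sides is
  the squared length of the component of \<open>u\<close> in the contact plane.\<close>

lemma \<alpha>_square_le:
  assumes p: "p \<in> points A" and u: "u \<in> tangent_space A p"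
  shows "(\<alpha> p u)\<^sup>2 \<le> g p u u"
proof -
  note X = X_tangent[OF p]
  define w where "w = (\<lambda>c. 1 *\<^sub>R u c + (- \<alpha> p u) *\<^sub>R X p c)"
  have w: "w \<in> tangent_space A p" unfolding w_def by (rule tangent_lincomb[OF u X])
  have lin: "g p v w = 1 * g p v u + (- \<alpha> p u) * g p v (X p)" if "v \<in> tangent_space A p" for v
    using lin_g[OF p that] u X unfolding linear_form_on_def w_def by blast
  have "\<alpha> p w = 0"
    using \<alpha>_lincomb[OF p u X, of 1 "- \<alpha> p u"] by (simp only: w_def \<alpha>_X[OF p])
  then have "g p w w = g p w u"
    using lin[OF w] by (simp add: g_X p w)
  also have "\<dots> = g p u u - (\<alpha> p u)\<^sup>2"
    using lin[OF u] sym_g[OF p w u] by (simp add: g_X p u power2_eq_square)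
  moreover have "g p w w \<ge> 0"
  proof (cases "w = (\<lambda>c. 0)")
    case True
    have "g p w (\<lambda>c. 0 *\<^sub>R w c + 0 *\<^sub>R w c) = 0 * g p w w + 0 * g p w w"
      using lin_g[OF p w] w unfolding linear_form_on_def by blast
    then show ?thesis using True by simp
  qed (use pos_g[OF p w] in auto)
  ultimately show ?thesis by simp
qed

context
  fixes k :: real
  assumes k: "k > 0"
begin

text \<open>With the same \<open>J\<close> and the same rotation, \<open>g'\<close> is the metric \<open>(1 / \<theta>) d\<alpha>'(u, J v) + \<alpha>'(u) \<alpha>'(v)\<close> that
  \<open>\<alpha>' = k \<alpha>\<close> determines.\<close>

definition "\<alpha>' = (\<lambda>p v. k * \<alpha> p v)"
definition "X' = (\<lambda>p c. (1 / k) *\<^sub>R X p c)"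
definition "g' = (\<lambda>p u v. k * g p u v + (k\<^sup>2 - k) * (\<alpha> p u * \<alpha> p v))"

lemma \<alpha>'_apply: "\<alpha>' p v = k * \<alpha> p v"
  by (simp add: \<alpha>'_def)

lemma form_comp_rescale: "form_comp A c \<alpha>' i = (\<lambda>x. k * form_comp A c \<alpha> i x)"
  by (rule ext) (simp add: form_comp_def \<alpha>'_def)

lemma smooth_\<alpha>': "smooth_1_form A \<alpha>'"
  using smooth_\<alpha> unfolding smooth_1_form_def form_comp_rescale
  by (auto simp: linear_form_on_def \<alpha>'_def algebra_simps
      intro!: smooth_on_mult chart_open smooth_on_const)

lemma ext_deriv_rescale:
  assumes p: "p \<in> points A"
  shows "ext_deriv A \<alpha>' p u v = k * ext_deriv A \<alpha> p u v"
proof -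
  have c: "chart_at A p \<in> A" "p \<in> dom_of (chart_at A p)" using chart_at p by auto
  have "form_comp A (chart_at A p) \<alpha> i differentiable (at (coord (chart_at A p) p))" for i
    using smooth_\<alpha> c chart_open(2)[OF c(1)] unfolding smooth_1_form_def
    by (auto intro!: smooth_on_differentiable)
  then show ?thesis
    by (simp add: ext_deriv_def Let_def form_comp_rescale partial_cmult sum_distrib_left algebra_simps)
qed

lemma contact_rescale: "contact_form_for A \<xi> \<alpha>'"
proof -
  have "contact_form A \<alpha>'"
    unfolding contact_form_def
  proof (intro conjI smooth_\<alpha>' ballI impI)
    fix p u v w
    assume *: "p \<in> points A" "u \<in> tangent_space A p" "v \<in> tangent_space A p" "w \<in> tangent_space A p"
      "det (vector [u (chart_at A p), v (chart_at A p), w (chart_at A p)] :: real^3^3) > 0"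
    have "\<alpha> p u * ext_deriv A \<alpha> p v w + \<alpha> p v * ext_deriv A \<alpha> p w u
          + \<alpha> p w * ext_deriv A \<alpha> p u v > 0" (is "?V > 0")
      using contact * unfolding contact_form_def by blast
    then have "k\<^sup>2 * ?V > 0" using k by simp
    then show "\<alpha>' p u * ext_deriv A \<alpha>' p v w + \<alpha>' p v * ext_deriv A \<alpha>' p w u
          + \<alpha>' p w * ext_deriv A \<alpha>' p u v > 0"
      using *(1) by (simp add: ext_deriv_rescale \<alpha>'_apply power2_eq_square algebra_simps)
  qed
  then show ?thesis
    using k by (auto simp: contact_form_for_def \<xi>_eq \<alpha>'_def)
qed

lemma reeb_rescale: "reeb_field A \<alpha>' X'"
  unfolding reeb_field_def smooth_vector_field_def
proof (intro conjI ballI allI)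
  fix p assume p: "p \<in> points A"
  note X = X_tangent[OF p]
  show "X' p \<in> tangent_space A p"
    using tangent_lincomb[OF X X, of "1 / k" 0] by (simp add: X'_def)
  show "\<alpha>' p (X' p) = 1"
    using \<alpha>_lincomb[OF p X X, of "1 / k" 0] k by (simp add: X'_def \<alpha>'_def \<alpha>_X p)
  fix v assume "v \<in> tangent_space A p"
  moreover have "ext_deriv A \<alpha> p (X' p) v = (1 / k) * ext_deriv A \<alpha> p (X p) v"
    by (simp add: ext_deriv_def Let_def X'_def sum_divide_distrib)
  ultimately show "ext_deriv A \<alpha>' p (X' p) v = 0"
    by (simp add: ext_deriv_rescale p d\<alpha>_X)
next
  fix c i assume c: "c \<in> A"
  have "smooth_on (img_of c) (\<lambda>x. (1 / k) * X (coord_inv c x) c $ i)"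
    using reeb c unfolding reeb_field_def smooth_vector_field_def
    by (intro smooth_on_mult chart_open smooth_on_const) auto
  then show "smooth_on (img_of c) (\<lambda>x. X' (coord_inv c x) c $ i)"
    by (simp add: X'_def)
qed

lemma extend_endo_rescale: "extend_endo \<alpha>' X' J = extend_endo \<alpha> X J"
  using k by (intro ext) (simp add: extend_endo_def \<alpha>'_def X'_def)

lemma metric_rescale: "metric_in c g' y = k *\<^sub>R metric_in c g y + (k\<^sup>2 - k) *\<^sub>R outer (form_in c \<alpha> y) (form_in c \<alpha> y)"
  by (simp add: vec_eq_iff metric_matrix_def g'_def form_in_def form_comp_def)

lemma riemannian_rescale: "riemannian_metric A g'"
  unfolding riemannian_metric_def
proof (intro conjI ballI allI impI)
  fix p u assume p: "p \<in> points A" and u: "u \<in> tangent_space A p"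
  show "linear_form_on (tangent_space A p) (g' p u)"
    using lin_g[OF p u] lin_\<alpha>[OF p] by (simp add: linear_form_on_def g'_def algebra_simps)
  show "g' p u v = g' p v u" if "v \<in> tangent_space A p" for v
    using sym_g[OF p u that] by (simp add: g'_def mult.commute)
  show "g' p u u > 0" if "u \<noteq> (\<lambda>c. 0)"
  proof (cases "\<alpha> p u = 0")
    case True
    then show ?thesis using pos_g[OF p u that] k by (simp add: g'_def)
  next
    case False
    have "0 < k\<^sup>2 * (\<alpha> p u)\<^sup>2" using False k by simp
    also have "\<dots> = k * (\<alpha> p u)\<^sup>2 + (k\<^sup>2 - k) * (\<alpha> p u * \<alpha> p u)"
      by (simp add: power2_eq_square algebra_simps)
    also have "\<dots> \<le> g' p u u"
      using \<alpha>_square_le[OF p u] k by (simp add: g'_def)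
    finally show ?thesis .
  qed
next
  fix c i j assume c: "c \<in> A"
  have a: "smooth_on (img_of c) (\<lambda>x. form_in c \<alpha> x $ i)" for i
    using smooth_\<alpha> c by (simp add: smooth_1_form_def form_in_def)
  have G: "smooth_on (img_of c) (\<lambda>x. metric_in c g x $ i $ j)"
    using riemannian c by (simp add: riemannian_metric_def)
  have "smooth_on (img_of c) (\<lambda>x. k * metric_in c g x $ i $ j
      + (k\<^sup>2 - k) * (form_in c \<alpha> x $ i * form_in c \<alpha> x $ j))"
    by (intro smooth_on_add smooth_on_mult smooth_on_const chart_open c a G)
  then show "smooth_on (img_of c) (\<lambda>x. metric_in c g' x $ i $ j)"
    by (simp add: metric_rescale)
qed

lemma compatible_rescale: "compatible_metric A \<xi> \<theta> g' \<alpha>' X' J"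
  unfolding compatible_metric_def
proof (intro conjI ballI impI \<theta>_pos riemannian_rescale contact_rescale reeb_rescale)
  show "complex_structure_on A \<xi> \<alpha>' X' J"
    using complex by (simp add: complex_structure_on_def extend_endo_rescale)
next
  fix p u assume p: "p \<in> points A" and "u \<in> \<xi> p" "u \<noteq> (\<lambda>c. 0)"
  then have "ext_deriv A \<alpha> p u (J p u) > 0"
    using compatible unfolding compatible_metric_def by blast
  then show "ext_deriv A \<alpha>' p u (J p u) > 0" using k p by (simp add: ext_deriv_rescale)
next
  fix p u v assume "p \<in> points A" "u \<in> tangent_space A p" "v \<in> tangent_space A p"
  then show "g' p u v = 1 / \<theta> * ext_deriv A \<alpha>' p u (extend_endo \<alpha>' X' J p v) + \<alpha>' p u * \<alpha>' p v"
    by (simp add: g'_def g_eq extend_endo_rescale ext_deriv_rescale \<alpha>'_apply power2_eq_square algebra_simps)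
qed

lemma tors_rescale:
  assumes c: "c \<in> A" "p \<in> dom_of c"
  shows "torsion (metric_in c g') (field_in c X') (coord c p) = tors c p / k\<^sup>2"
proof -
  interpret r: compatible M A \<xi> \<theta> g' \<alpha>' X' J
    by unfold_locales (rule compatible_rescale)
  interpret c: compatible_coords "img_of c" \<theta> "metric_in c g" "form_in c \<alpha>" "field_in c X" "endo_in c"
    using in_coords c by blast
  have "metric_in c g' = (\<lambda>y. k *\<^sub>R metric_in c g y + (k\<^sup>2 - k) *\<^sub>R outer (form_in c \<alpha> y) (form_in c \<alpha> y))"
    using metric_rescale by blast
  moreover have "field_in c X' = (\<lambda>y. (1 / k) *\<^sub>R field_in c X y)"
    by (rule ext) (simp add: field_in_def X'_def)
  moreover have "invertible (metric_in c g' (coord c p))"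
    using r.coord_relations(1)[OF c] .
  ultimately show ?thesis
    using c.torsion_rescale[OF _ k, of "coord c p"] c by (simp add: tors_def)
qed

lemma ricci_rescale:
  "ricci_reeb_less A \<xi> g' X' J b \<longleftrightarrow> (\<forall>p\<in>points A. \<theta>\<^sup>2 / 2 - tors (chart_at A p) p / (4 * k\<^sup>2) < b)"
proof -
  interpret r: compatible M A \<xi> \<theta> g' \<alpha>' X' J
    by unfold_locales (rule compatible_rescale)
  have "r.tors (chart_at A p) p = tors (chart_at A p) p / k\<^sup>2" if "p \<in> points A" for p
    using tors_rescale chart_at that by (simp add: r.tors_def)
  then show ?thesis by (simp add: r.ricci_less_iff mult.commute)
qed

end

section \<open>A uniform lower bound for the torsion\<close>

text \<open>Near \<open>p\<close>, and in the chart selected at \<open>p\<close>, the torsion is continuous and stays above half its value at \<open>p\<close>.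
  By \<open>tors_chart\<close> this also bounds its values in the charts selected at the nearby points.\<close>

lemma tors_bounded_below:
  assumes pos: "\<And>p. p \<in> points A \<Longrightarrow> tors (chart_at A p) p > 0"
  obtains \<delta> where "\<delta> > 0" "\<And>p. p \<in> points A \<Longrightarrow> tors (chart_at A p) p \<ge> \<delta>"
proof -
  let ?t = "\<lambda>p. tors (chart_at A p) p"
  define N where "N p = {q \<in> dom_of (chart_at A p). tors (chart_at A p) q > ?t p / 2}" for p
  have N_open: "openin M (N p)" if p: "p \<in> points A" for p
  proof -
    define c where "c = chart_at A p"
    have c: "c \<in> A" using chart_at p by (simp add: c_def)
    interpret c: compatible_coords "img_of c" \<theta> "metric_in c g" "form_in c \<alpha>" "field_in c X" "endo_in c"
      using in_coords c by blast
    let ?f = "torsion (metric_in c g) (field_in c X)"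
    have "continuous_map (subtopology M (dom_of c)) (top_of_set (img_of c)) (coord c)"
      using chart_homeo[OF c] homeomorphic_imp_continuous_map by blast
    from continuous_map_compose[OF this, of euclideanreal ?f]
    have "continuous_map (subtopology M (dom_of c)) euclideanreal (\<lambda>q. ?f (coord c q))"
      using c.continuous_torsion by (simp add: o_def)
    then have "openin (subtopology M (dom_of c))
        {q \<in> topspace (subtopology M (dom_of c)). ?f (coord c q) \<in> {?t p / 2 <..}}"
      by (rule openin_continuous_map_preimage) simp
    moreover have "topspace (subtopology M (dom_of c)) = dom_of c"
      using dom_subset[OF c] by auto
    moreover have "N p = {q \<in> dom_of c. ?f (coord c q) \<in> {?t p / 2 <..}}"
      by (simp add: N_def tors_def c_def)
    ultimately have "openin (subtopology M (dom_of c)) (N p)" by (simp only:)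
    then show ?thesis using openin_trans_full chart_open(1)[OF c] by blast
  qed
  have "topspace M \<subseteq> \<Union> (N ` points A)"
    using pos chart_at(2) by (fastforce simp: topspace_eq N_def)
  moreover have "compact_space M"
    using manifold by (simp add: closed_connected_oriented_3_manifold_def)
  ultimately obtain \<F> where \<F>: "finite \<F>" "\<F> \<subseteq> N ` points A" "topspace M \<subseteq> \<Union>\<F>"
    using N_open unfolding compact_space_alt by (metis (no_types, lifting) imageE)
  then obtain F where F: "finite F" "F \<subseteq> points A" "\<F> = N ` F"
    using finite_subset_image by metis
  define \<delta> where "\<delta> = Min (insert 1 ((\<lambda>p. ?t p / 2) ` F))"
  show ?thesis
  proof
    show "\<delta> > 0" using F pos by (auto simp: \<delta>_def)
    fix q assume q: "q \<in> points A"
    then obtain p where p: "p \<in> F" "q \<in> N p" using \<F>(3) F(3) topspace_eq by blast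
    have c: "chart_at A p \<in> A" using chart_at F p by blast
    have "?t q = tors (chart_at A p) q"
      using p c chart_at[OF q] by (intro tors_chart) (auto simp: N_def)
    moreover have "\<delta> \<le> ?t p / 2" unfolding \<delta>_def using F p by (intro Min_le) auto
    ultimately show "?t q \<ge> \<delta>" using p by (simp add: N_def)
  qed
qed

end

theorem theorem1p11:
  fixes M :: "'a topology" and A :: "'a chart set"
    and \<xi> :: "'a \<Rightarrow> 'a tangent set" and \<theta> c :: real
  assumes "closed_connected_oriented_3_manifold M A"
    and "contact_structure A \<xi>"
    and "\<theta> > 0"
    and "\<exists>g \<alpha> X J. compatible_metric A \<xi> \<theta> g \<alpha> X J \<and> ricci_reeb_less A \<xi> g X J (\<theta>\<^sup>2 / 2)"
    and "c \<le> \<theta>\<^sup>2 / 2"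
  shows "\<exists>g \<alpha> X J. compatible_metric A \<xi> \<theta> g \<alpha> X J \<and> ricci_reeb_less A \<xi> g X J c"
proof -
  obtain g \<alpha> X J where comp: "compatible_metric A \<xi> \<theta> g \<alpha> X J"
    and less: "ricci_reeb_less A \<xi> g X J (\<theta>\<^sup>2 / 2)"
    using assms(4) by blast
  interpret compatible M A \<xi> \<theta> g \<alpha> X J
    by unfold_locales (use assms(1) comp in auto)
  obtain \<delta> where \<delta>: "\<delta> > 0" "\<And>p. p \<in> points A \<Longrightarrow> tors (chart_at A p) p \<ge> \<delta>"
    using tors_bounded_below less by (auto simp: ricci_less_iff)
  \<comment> \<open>The constant \<open>k\<close> solves \<open>\<theta>\<^sup>2 / 2 - \<delta> / (4 * k\<^sup>2) = c - 1\<close>.\<close>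
  define s where "s = \<theta>\<^sup>2 / 2 - c + 1"
  have s: "s > 0" using assms(5) by (simp add: s_def)
  define k where "k = sqrt (\<delta> / (4 * s))"
  have k: "k > 0" using \<delta>(1) s by (simp add: k_def)
  have k2: "4 * k\<^sup>2 = \<delta> / s" using \<delta>(1) s by (simp add: k_def)
  have "\<theta>\<^sup>2 / 2 - tors (chart_at A p) p / (4 * k\<^sup>2) < c" if "p \<in> points A" for p
  proof -
    have "s = \<delta> / (4 * k\<^sup>2)" using \<delta>(1) s by (simp add: k2)
    also have "\<dots> \<le> tors (chart_at A p) p / (4 * k\<^sup>2)"
      using \<delta>(2)[OF that] by (intro divide_right_mono) auto
    finally show ?thesis by (simp add: s_def)
  qed
  then show ?thesis
    using compatible_rescale[OF k] ricci_rescale[OF k] by blast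
qed

end
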